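(* Let $S=\{(x_i,y_i)\}_{i=1}^n$ be a dataset with $x_i\in\mathbb{R}^d$, $y_i\in\mathbb{R}$, satisfying the dataset assumptions listed in the context (with parameters $\alpha,\lambda_{\min},\gamma,B_d,b,R,w$), let $k\ge1$, $\epsilon>0$ and $\delta\in(0,1)$. Then, with probability at least $1-2\delta$ (over the random choice of the sub-sample $A$), the solution $(\theta_1^+,\dots,\theta_k^+)$ returned by the sub-sampling algorithm described in the context satisfies $$L(\theta_1^+,\dots,\theta_k^+)\le L(\theta_1^*,\dots,\theta_k^* )+\epsilon,$$ provided $|A|=\tilde\Omega\left(\frac{1}{\epsilon^2}\,k^2\,\frac{\alpha}{\lambda_{\min}}\left(d+\log\frac{k}{\delta}\right)\right)$.
   Context: Objective: $L(\theta_1,\dots,\theta_k)=\frac1n\sum_{i=1}^n\min_{j\in[k]}(y_i-\langle x_i,\theta_j\rangle)^2$, and $(\theta_1^*,\dots,\theta_k^* )\in\arg\min L$. $\{B_i^*\}_{i=1}^k$ is the optimal partition of the samples of $S$: $\theta_i^*$ is the least-squares solution on $B_i^*$, and together they minimize $L$. Notation: for $P\subseteq S$, $\theta_{ls}(P)=\arg\min_\theta\sum_{i\in P}(y_i-\langle\theta,x_i\rangle)^2$ and $\mathcal{E}_{ls}(P,\theta)=\sum_{i\in P}(y_i-\langle\theta,x_i\rangle)^2$. Given $\theta_1,\dots,\theta_k$, $S_{\theta_l}(P)=\{i\in P: l=\arg\min_{j\in[k]}(y_i-\langle\theta_j,x_i\rangle)^2\}$ (ties broken so that these sets partition $P$).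 For $B\subseteq S$, $\Sigma_B=\frac1{|B|}\sum_{i\in B}x_ix_i^T$. Sub-sampling algorithm: (1) select a (multi)set $A$ of data points uniformly at random with replacement from $S$. (2) For each partition $\{P_i\}_{i=1}^k$ of $A$, let $\theta_i=\theta_{ls}(P_i)$, partition all samples as $S=\bigcup_{i=1}^kS_{\theta_i}(S)$, and let $\mathcal{E}(\{P_i\})=\frac1n\sum_{i=1}^k\mathcal{E}_{ls}(S_{\theta_i}(S),\theta_i)$. (3) Take the $\theta_i$'s corresponding to the partition of $A$ minimizing $\mathcal{E}(\{P_i\})$, and return $\theta_i^+=\theta_{ls}(S_{\theta_i}(S))$, $i\in[k]$. Dataset assumptions: - $\alpha_i:=|B_i^*|/n\ge\alpha>0$ for all $i\in[k]$. - The minimum eigenvalue of $\Sigma_{B_i^*}$ satisfies $\lambda_{\min}(\Sigma_{B_i^*})>\lambda_{\min}>0$ for all $i\in[k]$. - $\|\Sigma_{B_i^*}^{-1/2}x_j(y_j-\langle\theta_i^*,x_j\rangle)\|\le\gamma\sqrt d$ for all $j\in B_i^*$, $i\in[k]$ ($\gamma$ finite). - $\frac1{|B_i^*|}\sum_{j\in B_i^*}(y_j-\langle\theta_i^*,x_j\rangle)^2\le B_d$ for all $i\in[k]$. - $|y_i|\le b$ and $\|x_i\|\le R$ for all $i\in[n]$, and $\|\theta_i^*\|\le w$ for all $i\in[k]$. Here $\tilde\Omega(\cdot)$ hides logarithmic factors and factors depending on $b,R,w,B_d,\gamma$.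
   Formalization: In the required size of A, α is replaced by max(α, ε/k); this changes the bound only when ε > kα, where the stated bound fails (with tiny α it would allow |A| = 1). *)

theory Defs
  imports
    "HOL-Probability.Probability_Mass_Function"
    "Jordan_Normal_Form.Spectral_Radius"
begin

text \<open>
  A dataset of size \<open>n\<close> consists of \<open>x :: nat \<Rightarrow> real vec\<close> (with values in \<open>carrier_vec d\<close>) and
  \<open>y :: nat \<Rightarrow> real\<close>, read on the indices \<open>{..<n}\<close>; clusters and parameter vectors are indexed by
  \<open>{..<k}\<close>. Collections of samples are multisets of indices, since the sub-sample is drawn with
  replacement; a subset \<open>B\<close> of the dataset is the multiset \<open>mset_set B\<close>.
  Vectors are those of Jordan_Normal_Form because the hidden constant in the sample
  size must be uniform in the dimension \<open>d\<close>, so that \<open>d\<close> has to be quantified inside the statement.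
\<close>

definition vec_norm2 :: "real vec \<Rightarrow> real" where
  "vec_norm2 v = sqrt (scalar_prod v v)"

definition residual :: "(nat \<Rightarrow> real vec) \<Rightarrow> (nat \<Rightarrow> real) \<Rightarrow> real vec \<Rightarrow> nat \<Rightarrow> real" where
  "residual x y \<theta> i = y i - scalar_prod (x i) \<theta>"

definition ls_error ::
  "(nat \<Rightarrow> real vec) \<Rightarrow> (nat \<Rightarrow> real) \<Rightarrow> nat multiset \<Rightarrow> real vec \<Rightarrow> real" where
  "ls_error x y P \<theta> = (\<Sum>i\<in>#P. (residual x y \<theta> i)\<^sup>2)"

text \<open>
  The minimizer need not be unique (e.g. for an empty part), so \<open>\<theta> = \<theta>\<^sub>l\<^sub>s(P)\<close> is a relation:
  \<open>\<theta>\<close> is some least-squares solution on \<open>P\<close>.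
\<close>

definition is_ls_solution ::
  "nat \<Rightarrow> (nat \<Rightarrow> real vec) \<Rightarrow> (nat \<Rightarrow> real) \<Rightarrow> nat multiset \<Rightarrow> real vec \<Rightarrow> bool" where
  "is_ls_solution d x y P \<theta> \<longleftrightarrow> is_arg_min (ls_error x y P) (\<lambda>\<theta>. \<theta> \<in> carrier_vec d) \<theta>"

definition min_loss ::
  "nat \<Rightarrow> nat \<Rightarrow> (nat \<Rightarrow> real vec) \<Rightarrow> (nat \<Rightarrow> real) \<Rightarrow> (nat \<Rightarrow> real vec) \<Rightarrow> real" where
  "min_loss n k x y \<theta> = (\<Sum>i<n. Min ((\<lambda>j. (residual x y (\<theta> j) i)\<^sup>2) ` {..<k})) / real n"

definition is_partition :: "nat \<Rightarrow> nat \<Rightarrow> (nat \<Rightarrow> nat set) \<Rightarrow> bool" where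
  "is_partition n k B \<longleftrightarrow> disjoint_family_on B {..<k} \<and> (\<Union>i<k. B i) = {..<n}"

text \<open>
  \<open>Q\<close> is the family of the sets \<open>S\<^bsub>\<theta> l\<^esub>(S)\<close>, for some way of breaking ties.
\<close>

definition is_nearest_partition ::
  "nat \<Rightarrow> nat \<Rightarrow> (nat \<Rightarrow> real vec) \<Rightarrow> (nat \<Rightarrow> real) \<Rightarrow> (nat \<Rightarrow> real vec) \<Rightarrow> (nat \<Rightarrow> nat set) \<Rightarrow> bool"
where
  "is_nearest_partition n k x y \<theta> Q \<longleftrightarrow> is_partition n k Q \<and>
     (\<forall>l<k. \<forall>i\<in>Q l. is_arg_min (\<lambda>j. (residual x y (\<theta> j) i)\<^sup>2) (\<lambda>j. j < k) l)"

definition is_optimal ::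
  "nat \<Rightarrow> nat \<Rightarrow> nat \<Rightarrow> (nat \<Rightarrow> real vec) \<Rightarrow> (nat \<Rightarrow> real) \<Rightarrow> (nat \<Rightarrow> nat set)
    \<Rightarrow> (nat \<Rightarrow> real vec) \<Rightarrow> bool"
where
  "is_optimal d n k x y B \<theta> \<longleftrightarrow>
     is_arg_min (min_loss n k x y) (\<lambda>\<theta>. \<forall>j<k. \<theta> j \<in> carrier_vec d) \<theta> \<and>
     is_nearest_partition n k x y \<theta> B \<and>
     (\<forall>i<k. is_ls_solution d x y (mset_set (B i)) (\<theta> i))"

definition second_moment :: "nat \<Rightarrow> (nat \<Rightarrow> real vec) \<Rightarrow> nat set \<Rightarrow> real mat" where
  "second_moment d x B =
     mat d d (\<lambda>(p, q). (\<Sum>i\<in>B. vec_index (x i) p * vec_index (x i) q) / real (card B))"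

definition min_eigenvalue :: "real mat \<Rightarrow> real" where
  "min_eigenvalue M = Min (spectrum M)"

definition psd :: "nat \<Rightarrow> real mat \<Rightarrow> bool" where
  "psd d M \<longleftrightarrow> M \<in> carrier_mat d d \<and> transpose_mat M = M \<and>
     (\<forall>v\<in>carrier_vec d. 0 \<le> scalar_prod v (M *\<^sub>v v))"

text \<open>
  \<open>M\<^sup>-\<^sup>1\<^sup>/\<^sup>2\<close>: the positive semidefinite square root of the inverse of \<open>M\<close>
  (meaningful for positive definite \<open>M\<close>).
\<close>

definition inv_sqrt_mat :: "nat \<Rightarrow> real mat \<Rightarrow> real mat" where
  "inv_sqrt_mat d M = (THE T. psd d T \<and> (T * T) * M = 1\<^sub>m d)"

definition dataset_assumptions ::
  "nat \<Rightarrow> nat \<Rightarrow> nat \<Rightarrow> (nat \<Rightarrow> real vec) \<Rightarrow> (nat \<Rightarrow> real) \<Rightarrow> (nat \<Rightarrow> nat set) \<Rightarrow> (nat \<Rightarrow> real vec)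
    \<Rightarrow> real \<Rightarrow> real \<Rightarrow> real \<Rightarrow> real \<Rightarrow> real \<Rightarrow> real \<Rightarrow> real \<Rightarrow> bool"
where
  "dataset_assumptions d n k x y B \<theta> \<alpha> lmin \<gamma> Bd b R w \<longleftrightarrow>
     0 < \<alpha> \<and> (\<forall>i<k. \<alpha> \<le> real (card (B i)) / real n) \<and>
     0 < lmin \<and> (\<forall>i<k. lmin < min_eigenvalue (second_moment d x (B i))) \<and>
     (\<forall>i<k. \<forall>j\<in>B i.
        vec_norm2 (inv_sqrt_mat d (second_moment d x (B i)) *\<^sub>v (residual x y (\<theta> i) j \<cdot>\<^sub>v x j))
          \<le> \<gamma> * sqrt (real d)) \<and>
     (\<forall>i<k. (\<Sum>j\<in>B i. (residual x y (\<theta> i) j)\<^sup>2) / real (card (B i)) \<le> Bd) \<and>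
     (\<forall>i<n. \<bar>y i\<bar> \<le> b \<and> vec_norm2 (x i) \<le> R) \<and>
     (\<forall>i<k. vec_norm2 (\<theta> i) \<le> w)"

text \<open>Parts beyond \<open>k\<close> are fixed to be empty; parts below \<open>k\<close> may be empty as well.\<close>

definition is_mset_partition :: "nat \<Rightarrow> nat multiset \<Rightarrow> (nat \<Rightarrow> nat multiset) \<Rightarrow> bool" where
  "is_mset_partition k A P \<longleftrightarrow> (\<Sum>i<k. P i) = A \<and> (\<forall>i\<ge>k. P i = {#})"

definition subsample :: "nat \<Rightarrow> nat \<Rightarrow> nat multiset pmf" where
  "subsample n m = map_pmf mset (replicate_pmf m (pmf_of_set {..<n}))"

text \<open>
  \<open>\<theta>p\<close> is a possible output of the algorithm on the sub-sample \<open>A\<close>. Every choice of least-squares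
  solutions \<open>\<Theta> P\<close>, of tie-breaking in the induced partition \<open>Q P\<close> of the whole dataset, of the
  minimizing partition \<open>P\<close> and of the final least-squares solutions is allowed.
\<close>

definition subsampling_output ::
  "nat \<Rightarrow> nat \<Rightarrow> nat \<Rightarrow> (nat \<Rightarrow> real vec) \<Rightarrow> (nat \<Rightarrow> real) \<Rightarrow> nat multiset
    \<Rightarrow> (nat \<Rightarrow> real vec) \<Rightarrow> bool"
where
  "subsampling_output d n k x y A \<theta>p \<longleftrightarrow>
     (\<exists>\<Theta> Q P.
        (\<forall>P'. is_mset_partition k A P' \<longrightarrow>
           (\<forall>i<k. is_ls_solution d x y (P' i) (\<Theta> P' i)) \<and>
           is_nearest_partition n k x y (\<Theta> P') (Q P')) \<and>
        is_arg_min (\<lambda>P'. (\<Sum>i<k. ls_error x y (mset_set (Q P' i)) (\<Theta> P' i)) / real n)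
          (is_mset_partition k A) P \<and>
        (\<forall>i<k. is_ls_solution d x y (mset_set (Q P i)) (\<theta>p i)))"

definition sample_rate :: "nat \<Rightarrow> nat \<Rightarrow> real \<Rightarrow> real \<Rightarrow> real \<Rightarrow> real \<Rightarrow> real" where
  "sample_rate k d \<alpha> lmin \<epsilon> \<delta> =
     1 / \<epsilon>\<^sup>2 * (real k)\<^sup>2 * (\<alpha> / lmin) * (real d + ln (real k / \<delta>))"

text \<open>
  The logarithm of which a fixed power is absorbed by the soft-Omega notation. It is at least
  \<open>1\<close> and involves exactly the quantities the rate depends on (in particular not \<open>n\<close>).
\<close>

definition log_factor :: "nat \<Rightarrow> nat \<Rightarrow> real \<Rightarrow> real \<Rightarrow> real \<Rightarrow> real \<Rightarrow> real" where
  "log_factor k d \<alpha> lmin \<epsilon> \<delta> =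
     ln (exp 1 + real k + real d + 1 / \<alpha> + 1 / lmin + 1 / \<epsilon> + 1 / \<delta>)"

text \<open>
  The sample-size requirement \<open>m = \<Omega>(sample_rate)\<close> up to the factor \<open>C\<close> and the \<open>p\<close>-th power of the
  logarithm, in the regime of small \<open>\<epsilon>\<close>: as soon as \<open>\<epsilon> \<le> k \<alpha>\<close> the maximum is \<open>\<alpha>\<close>. For larger
  \<open>\<epsilon>\<close> the mass \<open>\<alpha>\<close> is replaced by \<open>\<epsilon> / k\<close>: since \<open>\<alpha>\<close> is only a lower bound for the cluster
  masses, the rate with \<open>\<alpha>\<close> itself would tend to \<open>0\<close> for fixed \<open>\<epsilon>\<close> as \<open>\<alpha>\<close> tends to \<open>0\<close>, and
  a single sample cannot suffice.
\<close>

definition enough_samples ::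
  "real \<Rightarrow> nat \<Rightarrow> nat \<Rightarrow> nat \<Rightarrow> real \<Rightarrow> real \<Rightarrow> real \<Rightarrow> real \<Rightarrow> nat \<Rightarrow> bool" where
  "enough_samples C p k d \<alpha> lmin \<epsilon> \<delta> m \<longleftrightarrow>
     real m \<ge> C * log_factor k d \<alpha> lmin \<epsilon> \<delta> ^ p
              * sample_rate k d (max \<alpha> (\<epsilon> / real k)) lmin \<epsilon> \<delta>"

end

theory Submission
  imports Defs
begin

text \<open>
  Let \<open>W\<close> bound the data and the residuals near the optimum. If \<open>\<epsilon> \<ge> W\<^sup>2\<close> there is nothing to do, since
  the final least-squares step beats the zero parameter. Otherwise split the sub-sample along the
  optimal clusters. The algorithm minimizes over all partitions, so it is enough that this one
  partition yields parameters \<open>\<Theta>\<close> of loss at most \<open>L(\<theta>\<^sup>*) + \<epsilon>\<close>.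

  A cluster of mass below \<open>\<tau> = \<epsilon> / (k W\<^sup>2)\<close> costs at most \<open>\<epsilon> / k\<close> even if it is served by the parameter
  of some large cluster. For a cluster of mass at least \<open>\<tau>\<close>, moving \<open>\<theta>\<^sub>i\<^sup>*\<close> by \<open>v\<close> increases the expected
  squared error by a quadratic form \<open>Q v\<close> (normal equations) with \<open>Q v \<ge> h (v \<bullet> v)\<close> for
  \<open>h = \<tau> \<lambda>\<^sub>m\<^sub>i\<^sub>n\<close>. The variance of the increase of a random sample is \<open>O(W\<^sup>2 Q v)\<close>, so a Chernoff bound over a
  grid of the unit ball shows that the empirical increase is positive on the whole level set \<open>Q = h\<close>
  except with probability \<open>(O(d W\<^sup>2 / h)) ^ d * exp (- m h / O(W\<^sup>2))\<close>. By convexity the empirical minimizer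
  then lies in \<open>{Q \<le> h}\<close>, which costs at most \<open>h \<le> \<epsilon> / k\<close>.
\<close>

subsection \<open>Smallest eigenvalue and quadratic form\<close>

text \<open>A nonzero linear term would dominate the quadratic one near 0 and take both signs. This
  first-order condition yields both the eigenvector equation and the normal equations.\<close>

lemma linear_coefficient_eq_0:
  fixes a b :: real
  assumes "\<And>t. 0 \<le> t\<^sup>2 * a - 2 * t * b"
  shows "b = 0"
proof (rule ccontr)
  assume "b \<noteq> 0"
  \<comment> \<open>With this choice \<open>t\<^sup>2 * (\<bar>a\<bar> + 1) = t * b\<close>, so the
    quadratic term makes up for only half of the linear one.\<close>
  define t where "t = b / (\<bar>a\<bar> + 1)"
  have tb: "t * (\<bar>a\<bar> + 1) = b" unfolding t_def by simp
  have "t\<^sup>2 * a - 2 * t * b \<le> t\<^sup>2 * (\<bar>a\<bar> + 1) - 2 * t * b"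
    by (intro diff_right_mono mult_left_mono) auto
  also have "\<dots> = t * (t * (\<bar>a\<bar> + 1)) - 2 * t * b"
    by (simp add: power2_eq_square)
  also have "\<dots> = - (t * b)" unfolding tb by simp
  also have "\<dots> = - (b\<^sup>2 / (\<bar>a\<bar> + 1))"
    unfolding t_def by (simp add: power2_eq_square)
  also have "\<dots> < 0" using \<open>b \<noteq> 0\<close> by simp
  finally show False using assms[of t] by simp
qed

lemma scalar_prod_sq_le:
  fixes u v :: "real vec"
  assumes "dim_vec u = dim_vec v"
  shows "(scalar_prod u v)\<^sup>2 \<le> scalar_prod u u * scalar_prod v v"
  using Cauchy_Schwarz_ineq_sum[of "vec_index u" "vec_index v" "{0..<dim_vec v}"] assms
  by (simp add: scalar_prod_def power2_eq_square)

lemma scalar_prod_self_nonneg: "0 \<le> scalar_prod v v" for v :: "real vec"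
  by (simp add: scalar_prod_def sum_nonneg)

lemma abs_scalar_prod_le:
  assumes "u \<in> carrier_vec d" "v \<in> carrier_vec d"
  shows "\<bar>scalar_prod u v\<bar> \<le> vec_norm2 u * vec_norm2 v"
proof -
  have "\<bar>scalar_prod u v\<bar> = sqrt ((scalar_prod u v)\<^sup>2)" by simp
  also have "\<dots> \<le> sqrt (scalar_prod u u * scalar_prod v v)"
    using assms by (intro real_sqrt_le_mono scalar_prod_sq_le) auto
  finally show ?thesis by (simp add: vec_norm2_def real_sqrt_mult)
qed

lemma scalar_prod_add_smult:
  fixes a v w :: "real vec"
  assumes "a \<in> carrier_vec d" "v \<in> carrier_vec d" "w \<in> carrier_vec d"
  shows "scalar_prod a (v + t \<cdot>\<^sub>v w) = scalar_prod a v + t * scalar_prod a w"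
  using assms by (simp add: scalar_prod_add_distrib[of _ d])

lemma abs_index_le_vec_norm2:
  assumes "p < dim_vec v"
  shows "\<bar>vec_index v p\<bar> \<le> vec_norm2 v"
proof -
  have "(vec_index v p)\<^sup>2 \<le> scalar_prod v v"
    unfolding scalar_prod_def power2_eq_square using assms
    by (intro member_le_sum) auto
  then show ?thesis
    unfolding vec_norm2_def by (metis real_sqrt_abs real_sqrt_le_mono)
qed

text \<open>The unit sphere is encoded by functions that vanish from \<open>d\<close> on. It is then
  a closed subset of a product of factors \<open>{-1..1}\<close> and \<open>{0}\<close>, which is
  compact by Tychonoff, for every value of \<open>d\<close>.\<close>

lemma compact_sphere_functions:
  "compact {f :: nat \<Rightarrow> real. (\<forall>i\<ge>d. f i = 0) \<and> (\<Sum>i<d. (f i)\<^sup>2) = 1}" (is "compact ?S")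
proof -
  let ?K = "\<lambda>i. if i < d then {-1..1} else {0::real}"
  have "compactin (product_topology (\<lambda>_. euclidean) UNIV) (PiE UNIV ?K)"
    unfolding compactin_PiE by auto
  then have "compact (PiE UNIV ?K)"
    by (simp add: euclidean_product_topology)
  moreover have "closed {f :: nat \<Rightarrow> real. (\<Sum>i<d. (f i)\<^sup>2) = 1}"
    by (intro closed_Collect_eq continuous_intros continuous_on_product_coordinates)
  moreover have "?S = PiE UNIV ?K \<inter> {f. (\<Sum>i<d. (f i)\<^sup>2) = 1}"
  proof (intro equalityI subsetI)
    fix f assume f: "f \<in> ?S"
    have "\<bar>f i\<bar> \<le> 1" if "i < d" for i
    proof -
      have "(f i)\<^sup>2 \<le> (\<Sum>i<d. (f i)\<^sup>2)" using that by (intro member_le_sum) auto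
      then show ?thesis using f by (simp add: abs_square_le_1)
    qed
    then show "f \<in> PiE UNIV ?K \<inter> {f. (\<Sum>i<d. (f i)\<^sup>2) = 1}"
      using f by (auto simp: abs_le_iff split: if_splits)
  qed (auto simp: PiE_iff not_less split: if_splits)
  ultimately show ?thesis by (simp add: compact_Int_closed)
qed

lemma scalar_prod_symmetric_mat:
  fixes M :: "real mat"
  assumes "M \<in> carrier_mat d d" "transpose_mat M = M" "u \<in> carrier_vec d" "v \<in> carrier_vec d"
  shows "scalar_prod u (M *\<^sub>v v) = scalar_prod v (M *\<^sub>v u)"
proof -
  have "scalar_prod u (M *\<^sub>v v) = scalar_prod (M *\<^sub>v u) v"
    using transpose_vec_mult_scalar[of M d d v u] assms by simp
  also have "\<dots> = scalar_prod v (M *\<^sub>v u)"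
    using assms by (intro comm_scalar_prod[of _ d]) auto
  finally show ?thesis .
qed

text \<open>A minimizer of the quadratic form on the unit sphere is an eigenvector whose eigenvalue is the minimum.\<close>

lemma min_eigenvalue_le_quadratic_form:
  assumes d: "1 \<le> d" and M: "M \<in> carrier_mat d d" and sym: "transpose_mat M = M"
    and v: "v \<in> carrier_vec d"
  shows "min_eigenvalue M * scalar_prod v v \<le> scalar_prod v (M *\<^sub>v v)"
proof -
  define S where "S = {f :: nat \<Rightarrow> real. (\<forall>i\<ge>d. f i = 0) \<and> (\<Sum>i<d. (f i)\<^sup>2) = 1}"
  let ?q = "\<lambda>u. scalar_prod u (M *\<^sub>v u)"
  have q_eq: "?q (vec d f) = (\<Sum>i<d. \<Sum>j<d. f i * (M $$ (i, j) * f j))" for f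
    using M by (simp add: scalar_prod_def mult_mat_vec_def lessThan_atLeast0 sum_distrib_left)
  have S_iff: "f \<in> S \<longleftrightarrow> (\<forall>i\<ge>d. f i = 0) \<and> (\<Sum>i<d. (f i)\<^sup>2) = 1" for f
    by (simp add: S_def)
  have "continuous_on S (\<lambda>f. ?q (vec d f))"
    unfolding q_eq by (intro continuous_intros continuous_on_product_coordinates
        continuous_on_subset[OF continuous_on_product_coordinates]) auto
  moreover have "S \<noteq> {}"
  proof -
    have "(\<lambda>i. if i = 0 then 1 else 0) \<in> S"
      unfolding S_iff using d by (auto simp: if_distrib[of "\<lambda>x. x\<^sup>2"] sum.delta cong: if_cong)
    then show ?thesis by blast
  qed
  ultimately obtain f where f: "f \<in> S" and min: "\<And>g. g \<in> S \<Longrightarrow> ?q (vec d f) \<le> ?q (vec d g)"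
    using continuous_attains_inf[of S] compact_sphere_functions[of d, folded S_def] by blast
  define u where "u = vec d f"
  define \<mu> where "\<mu> = ?q u"
  have u: "u \<in> carrier_vec d" and uu: "scalar_prod u u = 1"
    using f by (auto simp: S_iff u_def scalar_prod_def power2_eq_square lessThan_atLeast0)
  have lower: "\<mu> * scalar_prod z z \<le> ?q z" if z: "z \<in> carrier_vec d" for z
  proof (cases "scalar_prod z z = 0")
    case True
    have "z = 0\<^sub>v d"
    proof (intro eq_vecI)
      fix p assume "p < dim_vec (0\<^sub>v d)"
      then show "vec_index z p = vec_index (0\<^sub>v d) p"
        using abs_index_le_vec_norm2[of p z] z True by (simp add: vec_norm2_def)
    qed (use z in auto)
    then show ?thesis using M by simp
  next
    case False
    define c where "c = sqrt (scalar_prod z z)"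
    have c: "c > 0" "c\<^sup>2 = scalar_prod z z"
      using False scalar_prod_self_nonneg[of z] by (auto simp: c_def)
    \<comment> \<open>Both sides of \<open>lower\<close> are homogeneous of degree two, so it is
      enough to compare on the sphere.\<close>
    define g where "g = (\<lambda>i. if i < d then vec_index z i / c else 0)"
    have gz: "vec d g = (1 / c) \<cdot>\<^sub>v z" using z by (intro eq_vecI) (auto simp: g_def)
    have "(\<Sum>i<d. (g i)\<^sup>2) = (\<Sum>i<d. (vec_index z i)\<^sup>2) / c\<^sup>2"
      unfolding sum_divide_distrib by (intro sum.cong) (auto simp: g_def power_divide)
    also have "(\<Sum>i<d. (vec_index z i)\<^sup>2) = c\<^sup>2"
      unfolding c(2) using z by (simp add: scalar_prod_def power2_eq_square lessThan_atLeast0)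
    also have "c\<^sup>2 / c\<^sup>2 = 1" using c(1) by simp
    finally have "g \<in> S" unfolding S_iff by (auto simp: g_def)
    from min[OF this] have "\<mu> \<le> ?q ((1 / c) \<cdot>\<^sub>v z)" by (simp add: \<mu>_def u_def gz)
    also have "\<dots> = ?q z / c\<^sup>2"
      using M z by (simp add: mult_mat_vec[of _ d d] power2_eq_square)
    finally have "\<mu> * c\<^sup>2 \<le> ?q z" using c(1) by (simp add: pos_le_divide_eq)
    then show ?thesis unfolding c(2) .
  qed
  \<comment> \<open>First-order condition at \<open>u\<close>: the gap between the sides of
    \<open>lower\<close> at \<open>u + t z\<close> vanishes for \<open>t = 0\<close> and is never
    negative, so its linear coefficient \<open>- 2 * b\<close> is 0. Tested on unit vectors, this
    says that \<open>u\<close> is an eigenvector for \<open>\<mu>\<close>.\<close>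
  have orth: "scalar_prod z (M *\<^sub>v u) - \<mu> * scalar_prod z u = 0" if z: "z \<in> carrier_vec d" for z
  proof -
    define a where "a = ?q z - \<mu> * scalar_prod z z"
    define b where "b = \<mu> * scalar_prod z u - scalar_prod z (M *\<^sub>v u)"
    have "0 \<le> t\<^sup>2 * a - 2 * t * b" for t
    proof -
      let ?w = "u + t \<cdot>\<^sub>v z"
      have w: "?w \<in> carrier_vec d" using u z by auto
      have Mu: "M *\<^sub>v u \<in> carrier_vec d" and Mz: "M *\<^sub>v z \<in> carrier_vec d" using M u z by auto
      have zu: "scalar_prod u z = scalar_prod z u" by (rule comm_scalar_prod[OF u z])
      have "M *\<^sub>v ?w = M *\<^sub>v u + t \<cdot>\<^sub>v (M *\<^sub>v z)"
        using M u z by (simp add: mult_add_distrib_mat_vec[of _ d d] mult_mat_vec[of _ d d])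
      then have "?q ?w = scalar_prod ?w (M *\<^sub>v u) + t * scalar_prod ?w (M *\<^sub>v z)"
        using scalar_prod_add_smult[OF w Mu Mz] by simp
      also have "\<dots> = scalar_prod (M *\<^sub>v u) ?w + t * scalar_prod (M *\<^sub>v z) ?w"
        using comm_scalar_prod[OF w Mu] comm_scalar_prod[OF w Mz] by simp
      also have "\<dots> = scalar_prod u (M *\<^sub>v u) + t * scalar_prod z (M *\<^sub>v u)
          + t * (scalar_prod u (M *\<^sub>v z) + t * ?q z)"
        unfolding scalar_prod_add_smult[OF Mu u z] scalar_prod_add_smult[OF Mz u z]
        using comm_scalar_prod[OF Mu u] comm_scalar_prod[OF Mu z]
          comm_scalar_prod[OF Mz u] comm_scalar_prod[OF Mz z] by simp
      also have "scalar_prod u (M *\<^sub>v z) = scalar_prod z (M *\<^sub>v u)"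
        by (rule scalar_prod_symmetric_mat[OF M sym u z])
      finally have q: "?q ?w = \<mu> + 2 * t * scalar_prod z (M *\<^sub>v u) + t\<^sup>2 * ?q z"
        by (simp add: \<mu>_def power2_eq_square algebra_simps)
      have "scalar_prod ?w ?w = scalar_prod u ?w + t * scalar_prod z ?w"
        unfolding scalar_prod_add_smult[OF w u z]
        using comm_scalar_prod[OF w u] comm_scalar_prod[OF w z] by simp
      also have "\<dots> = 1 + 2 * t * scalar_prod z u + t\<^sup>2 * scalar_prod z z"
        unfolding scalar_prod_add_smult[OF u u z] scalar_prod_add_smult[OF z u z] zu
        by (simp add: uu power2_eq_square algebra_simps)
      finally have "\<mu> * (1 + 2 * t * scalar_prod z u + t\<^sup>2 * scalar_prod z z) \<le> ?q ?w"
        using lower[OF w] by simp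
      then show ?thesis unfolding q a_def b_def by (simp add: algebra_simps)
    qed
    then have "b = 0" by (rule linear_coefficient_eq_0)
    then show ?thesis by (simp add: b_def)
  qed
  have "M *\<^sub>v u = \<mu> \<cdot>\<^sub>v u"
  proof (intro eq_vecI)
    fix p assume "p < dim_vec (\<mu> \<cdot>\<^sub>v u)"
    then have p: "p < d" using u by simp
    have "scalar_prod (unit_vec d p) w = vec_index w p" if "w \<in> carrier_vec d" for w :: "real vec"
      using p that by simp
    with orth[of "unit_vec d p"] M u p show "vec_index (M *\<^sub>v u) p = vec_index (\<mu> \<cdot>\<^sub>v u) p"
      by (simp del: index_mult_mat_vec)
  qed (use M u in auto)
  moreover have "u \<noteq> 0\<^sub>v d" using uu by auto
  ultimately have "\<mu> \<in> spectrum M"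
    using M u by (auto simp: spectrum_def eigenvalue_def eigenvector_def)
  then have "min_eigenvalue M \<le> \<mu>"
    unfolding min_eigenvalue_def using card_finite_spectrum(1)[OF M] by (intro Min_le) auto
  then have "min_eigenvalue M * scalar_prod v v \<le> \<mu> * scalar_prod v v"
    by (intro mult_right_mono scalar_prod_self_nonneg)
  also have "\<dots> \<le> ?q v" by (rule lower[OF v])
  finally show ?thesis .
qed

lemma second_moment_quadratic_form:
  assumes "\<And>i. i \<in> B \<Longrightarrow> x i \<in> carrier_vec d" "v \<in> carrier_vec d"
  shows "scalar_prod v (second_moment d x B *\<^sub>v v) =
    (\<Sum>i\<in>B. (scalar_prod (x i) v)\<^sup>2) / real (card B)"
proof -
  have "scalar_prod v (second_moment d x B *\<^sub>v v) =
    (\<Sum>p\<in>{0..<d}. \<Sum>q\<in>{0..<d}. \<Sum>i\<in>B.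
      vec_index v p * (vec_index (x i) p * vec_index (x i) q * vec_index v q) / real (card B))"
    using assms(2)
    by (simp add: second_moment_def scalar_prod_def mult_mat_vec_def sum_distrib_left
        sum_distrib_right sum_divide_distrib)
  also have "\<dots> = (\<Sum>i\<in>B. \<Sum>p\<in>{0..<d}. \<Sum>q\<in>{0..<d}.
      vec_index v p * (vec_index (x i) p * vec_index (x i) q * vec_index v q) / real (card B))"
    by (subst (2) sum.swap, subst sum.swap) (rule refl)
  also have "\<dots> = (\<Sum>i\<in>B. (scalar_prod (x i) v)\<^sup>2 / real (card B))"
    using assms
    by (intro sum.cong)
      (auto simp: scalar_prod_def power2_eq_square sum_product sum_divide_distrib ac_simps
        intro!: sum.cong)
  finally show ?thesis by (simp add: sum_divide_distrib)
qed

text \<open>Multiplying through by \<open>card B\<close> clears the denominator of the second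
  moment, so that the empty cluster is covered as well.\<close>

lemma second_moment_lower_bound:
  assumes "1 \<le> d" "finite B" "\<And>i. i \<in> B \<Longrightarrow> x i \<in> carrier_vec d" "v \<in> carrier_vec d"
    and "l \<le> min_eigenvalue (second_moment d x B)"
  shows "l * real (card B) * scalar_prod v v \<le> (\<Sum>i\<in>B. (scalar_prod (x i) v)\<^sup>2)"
proof (cases "B = {}")
  case False
  have sm: "second_moment d x B \<in> carrier_mat d d"
    "transpose_mat (second_moment d x B) = second_moment d x B"
    by (auto simp: second_moment_def mult.commute intro!: eq_matI)
  have "l * scalar_prod v v \<le> min_eigenvalue (second_moment d x B) * scalar_prod v v"
    using assms(5) by (intro mult_right_mono scalar_prod_self_nonneg)
  also have "\<dots> \<le> (\<Sum>i\<in>B. (scalar_prod (x i) v)\<^sup>2) / real (card B)"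
    using min_eigenvalue_le_quadratic_form[OF assms(1) sm assms(4)]
      second_moment_quadratic_form[OF assms(3,4)] by simp
  finally show ?thesis using False assms(2) by (simp add: field_simps card_gt_0_iff)
qed simp

subsection \<open>Lower tails and grids\<close>

lemma exp_minus_le_quadratic:
  fixes t :: real
  assumes "\<bar>t\<bar> \<le> 1"
  shows "exp (- t) \<le> 1 - t + t\<^sup>2"
proof (cases "t \<le> 0")
  case True
  then show ?thesis using exp_bound[of "- t"] assms by simp
next
  case False
  \<comment> \<open>The product equals \<open>1 + t ^ 3\<close>.\<close>
  have "1 \<le> (1 + t) * (1 - t + t\<^sup>2)"
    using False by (simp add: power2_eq_square algebra_simps)
  also have "\<dots> \<le> exp t * (1 - t + t\<^sup>2)"
    using assms by (intro mult_right_mono exp_ge_add_one_self) auto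
  finally show ?thesis by (simp add: exp_minus field_simps)
qed

text \<open>Chernoff's bound by induction on the number of draws. The threshold \<open>s\<close> is
  generalized because a first draw \<open>x\<close> leaves the threshold \<open>s - g x\<close> for
  the others; every draw contributes one factor \<open>\<rho>\<close>.\<close>

lemma emeasure_replicate_pmf_lower_tail:
  fixes g :: "'a \<Rightarrow> real"
  assumes c: "0 \<le> c" and \<rho>: "0 \<le> \<rho>"
    and mgf: "(\<integral>\<^sup>+x. ennreal (exp (- c * g x)) \<partial>measure_pmf p) \<le> ennreal \<rho>"
  shows "emeasure (replicate_pmf m p) {xs. (\<Sum>x\<leftarrow>xs. g x) \<le> s} \<le> ennreal (exp (c * s) * \<rho> ^ m)"
proof (induction m arbitrary: s)
  case 0
  have "indicator {xs. (\<Sum>x\<leftarrow>xs. g x) \<le> s} [] \<le> ennreal (exp (c * s))"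
    using c by (auto simp: indicator_def)
  then show ?case by simp
next
  case (Suc m)
  have "emeasure (replicate_pmf (Suc m) p) {xs. (\<Sum>x\<leftarrow>xs. g x) \<le> s} =
      (\<integral>\<^sup>+x. emeasure (map_pmf (\<lambda>xs. x # xs) (replicate_pmf m p)) {xs. (\<Sum>x\<leftarrow>xs. g x) \<le> s} \<partial>p)"
    by (simp add: map_pmf_def)
  also have "\<dots> = (\<integral>\<^sup>+x. emeasure (replicate_pmf m p) {xs. (\<Sum>x\<leftarrow>xs. g x) \<le> s - g x} \<partial>p)"
    by (intro nn_integral_cong) (auto simp: vimage_def algebra_simps)
  also have "\<dots> \<le> (\<integral>\<^sup>+x. ennreal (exp (c * (s - g x)) * \<rho> ^ m) \<partial>p)"
    by (intro nn_integral_mono Suc.IH)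
  also have "\<dots> = (\<integral>\<^sup>+x. ennreal (exp (c * s) * \<rho> ^ m) * ennreal (exp (- c * g x)) \<partial>p)"
    using \<rho> by (intro nn_integral_cong) (simp add: ennreal_mult[symmetric] exp_diff exp_minus field_simps)
  also have "\<dots> = ennreal (exp (c * s) * \<rho> ^ m) * (\<integral>\<^sup>+x. ennreal (exp (- c * g x)) \<partial>p)"
    by (intro nn_integral_cmult) auto
  also have "\<dots> \<le> ennreal (exp (c * s) * \<rho> ^ m) * ennreal \<rho>"
    by (intro mult_left_mono mgf) auto
  also have "\<dots> = ennreal (exp (c * s) * \<rho> ^ Suc m)"
    using \<rho> by (simp add: ennreal_mult[symmetric] mult.assoc mult.commute)
  finally show ?case .
qed

text \<open>
  The Bernstein-type condition that the second moment of \<open>g\<close> is dominated by its mean makes the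
  lower tail decay like \<open>exp (- c m H / 4)\<close> instead of the Hoeffding rate, which is quadratic in \<open>H\<close>.
\<close>

lemma prob_uniform_lower_tail:
  fixes g :: "nat \<Rightarrow> real" and H :: real
  assumes n: "1 \<le> n" and c: "0 \<le> c" and bounded: "\<And>j. j < n \<Longrightarrow> c * \<bar>g j\<bar> \<le> 1"
    and mean: "(\<Sum>j<n. g j) = real n * H"
    and second: "2 * c * (\<Sum>j<n. (g j)\<^sup>2) \<le> real n * H"
  shows "measure_pmf.prob (replicate_pmf m (pmf_of_set {..<n}))
      {xs. (\<Sum>x\<leftarrow>xs. g x) \<le> real m * H / 4} \<le> exp (- (c * real m * H / 4))"
proof -
  let ?p = "pmf_of_set {..<n}"
  have "(\<Sum>j<n. exp (- c * g j)) \<le> (\<Sum>j<n. 1 - c * g j + (c * g j)\<^sup>2)"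
    using exp_minus_le_quadratic bounded c by (intro sum_mono) (auto simp: abs_mult)
  also have "\<dots> = real n - c * (real n * H) + c\<^sup>2 * (\<Sum>j<n. (g j)\<^sup>2)"
    unfolding mean[symmetric]
    by (simp add: sum.distrib sum_subtractf sum_distrib_left power_mult_distrib)
  \<comment> \<open>By \<open>second\<close>, the quadratic term uses up at most half of the linear
    one.\<close>
  also have "\<dots> \<le> real n * (1 - c * H / 2)"
    using mult_left_mono[OF second c] by (simp add: power2_eq_square algebra_simps)
  also have "\<dots> \<le> real n * exp (- (c * H / 2))"
    using exp_ge_add_one_self[of "- (c * H / 2)"] by (intro mult_left_mono) auto
  finally have "(\<Sum>j<n. exp (- c * g j)) / real n \<le> exp (- (c * H / 2))"
    using n by (simp add: field_simps)
  then have mgf: "(\<integral>\<^sup>+x. ennreal (exp (- c * g x)) \<partial>measure_pmf ?p) \<le> ennreal (exp (- (c * H / 2)))"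
    using n by (subst nn_integral_pmf_of_set)
      (auto simp: lessThan_empty_iff sum_ennreal divide_ennreal ennreal_of_nat_eq_real_of_nat sum_nonneg)
  have "emeasure (replicate_pmf m ?p) {xs. (\<Sum>x\<leftarrow>xs. g x) \<le> real m * H / 4}
      \<le> ennreal (exp (c * (real m * H / 4)) * exp (- (c * H / 2)) ^ m)"
    by (intro emeasure_replicate_pmf_lower_tail c mgf) auto
  \<comment> \<open>The threshold, a quarter of the mean, gives back half of the exponent
    \<open>c * m * H / 2\<close>.\<close>
  also have "exp (c * (real m * H / 4)) * exp (- (c * H / 2)) ^ m = exp (- (c * real m * H / 4))"
    by (simp add: exp_of_nat_mult[symmetric] exp_add[symmetric] algebra_simps)
  finally show ?thesis
    by (simp add: measure_pmf.emeasure_eq_measure)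
qed

text \<open>The grid consists of the multiples of \<open>1 / D\<close> in the cube around the ball,
  \<open>2 * D + 1\<close> per coordinate; a vector is approximated by rounding each coordinate
  down. Grid points may lie outside the ball.\<close>

lemma unit_ball_grid:
  assumes D: "0 < D"
  obtains U :: "real vec set" where "finite U" "card U \<le> (2 * D + 1) ^ d" "U \<subseteq> carrier_vec d"
    "\<And>v. v \<in> carrier_vec d \<Longrightarrow> vec_norm2 v \<le> 1 \<Longrightarrow>
      \<exists>u\<in>U. \<forall>p<d. \<bar>vec_index u p - vec_index v p\<bar> \<le> 1 / real D"
proof -
  define F where "F = PiE {..<d} (\<lambda>_. {- int D..int D})"
  define U where "U = (\<lambda>f. vec d (\<lambda>p. real_of_int (f p) / real D)) ` F"
  have "card {- int D..int D} = 2 * D + 1" by simp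
  then have F: "finite F" "card F = (2 * D + 1) ^ d"
    by (auto simp: F_def card_PiE simp del: card_atLeastAtMost_int intro!: finite_PiE)
  have "\<exists>u\<in>U. \<forall>p<d. \<bar>vec_index u p - vec_index v p\<bar> \<le> 1 / real D"
    if v: "v \<in> carrier_vec d" "vec_norm2 v \<le> 1" for v
  proof -
    define f where "f = restrict (\<lambda>p. \<lfloor>vec_index v p * real D\<rfloor>) {..<d}"
    have vp: "\<bar>vec_index v p\<bar> \<le> 1" if "p < d" for p
      using abs_index_le_vec_norm2[of p v] v that by auto
    have "f \<in> F"
      unfolding F_def f_def
    proof (intro restrict_PiE_iff[THEN iffD2] ballI)
      fix p assume "p \<in> {..<d}"
      then have "- real D \<le> vec_index v p * real D" "vec_index v p * real D \<le> real D"
        using vp[of p] D mult_right_mono[of "-1" "vec_index v p" "real D"]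
          mult_right_mono[of "vec_index v p" 1 "real D"] by (auto simp: abs_le_iff)
      then show "\<lfloor>vec_index v p * real D\<rfloor> \<in> {- int D..int D}"
        by (auto simp: le_floor_iff floor_le_iff)
    qed
    moreover have "\<bar>real_of_int (f p) / real D - vec_index v p\<bar> \<le> 1 / real D" if "p < d" for p
    proof -
      have "\<bar>real_of_int (f p) - vec_index v p * real D\<bar> \<le> 1"
        using that by (simp add: f_def) linarith
      then have "\<bar>(real_of_int (f p) - vec_index v p * real D) / real D\<bar> \<le> 1 / real D"
        unfolding abs_divide using D by (simp add: divide_right_mono)
      then show ?thesis using D by (simp add: diff_divide_distrib)
    qed
    ultimately show ?thesis unfolding U_def by (intro bexI[OF _ imageI]) auto
  qed
  moreover have "card U \<le> (2 * D + 1) ^ d"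
    unfolding U_def F(2)[symmetric] by (intro card_image_le F)
  moreover have "finite U" "U \<subseteq> carrier_vec d" using F by (auto simp: U_def)
  ultimately show ?thesis using that by blast
qed

text \<open>Bounding every coordinate of \<open>a\<close> by its norm costs a factor
  \<open>d\<close>. It only refines the grid and so enters the sample size through a
  logarithm.\<close>

lemma abs_scalar_prod_diff_le:
  assumes "a \<in> carrier_vec d" "u \<in> carrier_vec d" "v \<in> carrier_vec d"
    and "\<And>p. p < d \<Longrightarrow> \<bar>vec_index u p - vec_index v p\<bar> \<le> e"
  shows "\<bar>scalar_prod a u - scalar_prod a v\<bar> \<le> vec_norm2 a * (real d * e)"
proof -
  have "scalar_prod a u - scalar_prod a v =
      (\<Sum>p\<in>{0..<d}. vec_index a p * (vec_index u p - vec_index v p))"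
    using assms by (simp add: scalar_prod_def sum_subtractf[symmetric] right_diff_distrib)
  also have "\<bar>\<dots>\<bar> \<le> (\<Sum>p\<in>{0..<d}. \<bar>vec_index a p * (vec_index u p - vec_index v p)\<bar>)"
    by (rule sum_abs)
  also have "\<dots> \<le> (\<Sum>p\<in>{0..<d}. vec_norm2 a * e)"
    unfolding abs_mult using assms abs_index_le_vec_norm2[of _ a]
    by (intro sum_mono mult_mono) (auto intro: order_trans[OF abs_ge_zero])
  finally show ?thesis by (simp add: ac_simps)
qed

subsection \<open>Least squares on a sub-sample\<close>

text \<open>
  The contribution of sample \<open>j\<close> to the squared-error increase on \<open>B\<close> when a parameter with
  residuals \<open>r\<close> is moved by \<open>v\<close>.
\<close>

definition excess :: "(nat \<Rightarrow> real vec) \<Rightarrow> (nat \<Rightarrow> real) \<Rightarrow> nat set \<Rightarrow> real vec \<Rightarrow> nat \<Rightarrow> real" where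
  "excess x r B v j =
    (if j \<in> B then (scalar_prod (x j) v)\<^sup>2 - 2 * r j * scalar_prod (x j) v else 0)"

text \<open>The normal equations cancel the linear part, so the mean excess is the quadratic form
  divided by \<open>n\<close>.\<close>

lemma sum_excess:
  assumes "B \<subseteq> {..<n}" "(\<Sum>j\<in>B. r j * scalar_prod (x j) v) = 0"
  shows "(\<Sum>j<n. excess x r B v j) = (\<Sum>j\<in>B. (scalar_prod (x j) v)\<^sup>2)"
proof -
  have "(\<Sum>j<n. excess x r B v j) =
      (\<Sum>j\<in>B. (scalar_prod (x j) v)\<^sup>2 - 2 * r j * scalar_prod (x j) v)"
    using assms(1) unfolding excess_def
    by (subst sum.inter_restrict[symmetric]) (auto simp: Int_absorb1)
  also have "\<dots> = (\<Sum>j\<in>B. (scalar_prod (x j) v)\<^sup>2) - 2 * (\<Sum>j\<in>B. r j * scalar_prod (x j) v)"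
    by (simp add: sum_subtractf sum_distrib_left mult.assoc)
  finally show ?thesis using assms(2) by simp
qed

text \<open>The excess factors as \<open>z * (z - 2 * r j)\<close> with second factor at most
  \<open>4 * W\<close> in absolute value. Its second moment is therefore dominated by the quadratic
  form, that is, by its own mean. The bound \<open>2 * W\<close> on \<open>z\<close> leaves room for
  grid points slightly off the level set.\<close>

lemma square_excess_le:
  assumes "0 \<le> W" "j \<in> B \<Longrightarrow> \<bar>scalar_prod (x j) v\<bar> \<le> 2 * W" "j \<in> B \<Longrightarrow> \<bar>r j\<bar> \<le> W"
  shows "(excess x r B v j)\<^sup>2 \<le> (if j \<in> B then 16 * W\<^sup>2 * (scalar_prod (x j) v)\<^sup>2 else 0)"
    and "\<bar>excess x r B v j\<bar> \<le> 8 * W\<^sup>2"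
proof -
  let ?z = "scalar_prod (x j) v"
  have eq: "excess x r B v j = ?z * (?z - 2 * r j)" if "j \<in> B"
    using that by (simp add: excess_def power2_eq_square algebra_simps)
  have le: "\<bar>?z - 2 * r j\<bar> \<le> 4 * W" if "j \<in> B"
    using assms(2,3)[OF that] by linarith
  then have "(?z - 2 * r j)\<^sup>2 \<le> 16 * W\<^sup>2" if "j \<in> B"
    using power_mono[OF le[OF that] abs_ge_zero, of 2] by (simp add: power_mult_distrib)
  then show "(excess x r B v j)\<^sup>2 \<le> (if j \<in> B then 16 * W\<^sup>2 * ?z\<^sup>2 else 0)"
    using eq by (auto simp: power_mult_distrib excess_def mult.commute intro: mult_left_mono)
  have "\<bar>?z\<bar> * \<bar>?z - 2 * r j\<bar> \<le> (2 * W) * (4 * W)" if "j \<in> B"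
    using assms le that by (intro mult_mono) auto
  then show "\<bar>excess x r B v j\<bar> \<le> 8 * W\<^sup>2"
    using eq by (cases "j \<in> B") (auto simp: abs_mult power2_eq_square excess_def)
qed

text \<open>The difference of the two values is \<open>(a - b) * (a + b - 2 * r j)\<close>, and the
  second factor is at most \<open>2 * W + W + 2 * W\<close>.\<close>

lemma abs_excess_diff_le:
  assumes "0 \<le> W" "0 \<le> e"
    and "j \<in> B \<Longrightarrow> \<bar>scalar_prod (x j) u - scalar_prod (x j) v\<bar> \<le> e"
    and "j \<in> B \<Longrightarrow> \<bar>scalar_prod (x j) u\<bar> \<le> 2 * W"
    and "j \<in> B \<Longrightarrow> \<bar>scalar_prod (x j) v\<bar> \<le> W" "j \<in> B \<Longrightarrow> \<bar>r j\<bar> \<le> W"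
  shows "\<bar>excess x r B u j - excess x r B v j\<bar> \<le> 5 * W * e"
proof (cases "j \<in> B")
  case True
  let ?a = "scalar_prod (x j) u" and ?b = "scalar_prod (x j) v"
  have "\<bar>excess x r B u j - excess x r B v j\<bar> = \<bar>?a + ?b - 2 * r j\<bar> * \<bar>?a - ?b\<bar>"
    using True unfolding abs_mult[symmetric]
    by (simp add: excess_def power2_eq_square algebra_simps)
  also have "\<dots> \<le> (5 * W) * e"
    using assms(3-6)[OF True] assms(1,2) by (intro mult_mono) linarith+
  finally show ?thesis .
qed (use assms in \<open>simp add: excess_def\<close>)

text \<open>By \<open>strong\<close> the level set lies in the unit ball. If the sample excess is
  nonpositive at some point of it, then at a nearby grid point it is at most a quarter of its mean,
  which is unlikely for each single grid point; a union bound over the grid finishes.\<close>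

lemma prob_excess_nonpos_le:
  fixes W h :: real
  assumes n: "1 \<le> n" and d: "1 \<le> d" and B: "B \<subseteq> {..<n}" and W: "1 \<le> W"
    and h: "0 < h" "h \<le> W\<^sup>2"
    and x: "\<And>j. j \<in> B \<Longrightarrow> x j \<in> carrier_vec d" "\<And>j. j \<in> B \<Longrightarrow> vec_norm2 (x j) \<le> W"
    and r: "\<And>j. j \<in> B \<Longrightarrow> \<bar>r j\<bar> \<le> W"
    and orth: "\<And>v. v \<in> carrier_vec d \<Longrightarrow> (\<Sum>j\<in>B. r j * scalar_prod (x j) v) = 0"
    and strong: "\<And>v. v \<in> carrier_vec d \<Longrightarrow>
      h * real n * scalar_prod v v \<le> (\<Sum>j\<in>B. (scalar_prod (x j) v)\<^sup>2)"
  shows "measure_pmf.prob (replicate_pmf m (pmf_of_set {..<n}))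
      {xs. \<exists>v\<in>carrier_vec d. (\<Sum>j\<in>B. (scalar_prod (x j) v)\<^sup>2) = h * real n \<and>
        (\<Sum>j\<leftarrow>xs. excess x r B v j) \<le> 0}
    \<le> (400 * W\<^sup>2 * real d / h) ^ d * exp (- (real m * h / (256 * W\<^sup>2)))"
    (is "measure_pmf.prob ?p ?E \<le> _")
proof -
  \<comment> \<open>The excess is at most \<open>8 * W\<^sup>2\<close>, so \<open>c\<close> times it
    is at most 1/4, and \<open>2 * c * 16 * W\<^sup>2 = 1\<close> is exactly what the second-moment
    condition of the tail bound requires.\<close>
  define c where "c = 1 / (32 * W\<^sup>2)"
  have c: "0 \<le> c" "c * W\<^sup>2 = 1 / 32" using W by (auto simp: c_def)
  \<comment> \<open>Chosen so that rounding to the grid moves inner products by at most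
    \<open>e = h / (80 * W)\<close> and hence each excess by at most
    \<open>5 * W * e = h / 16\<close>.\<close>
  define D where "D = nat \<lceil>80 * W\<^sup>2 * real d / h\<rceil>"
  have D: "80 * W\<^sup>2 * real d / h \<le> real D" "real D \<le> 80 * W\<^sup>2 * real d / h + 1"
    and ratio: "1 \<le> W\<^sup>2 * real d / h"
  proof -
    have "0 \<le> 80 * W\<^sup>2 * real d / h" using h W d by simp
    then show "80 * W\<^sup>2 * real d / h \<le> real D" "real D \<le> 80 * W\<^sup>2 * real d / h + 1"
      unfolding D_def by linarith+
    have "h * 1 \<le> W\<^sup>2 * real d" using h d by (intro mult_mono) auto
    then show "1 \<le> W\<^sup>2 * real d / h" using h by simp
  qed
  have D0: "0 < D" using D(1) ratio by (intro gr0I) auto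
  define e where "e = h / (80 * W)"
  have e: "0 \<le> e" "W * (real d * (1 / real D)) \<le> e" "5 * W * e = h / 16" "e \<le> W"
  proof -
    show "0 \<le> e" "5 * W * e = h / 16" using h W by (auto simp: e_def)
    have "80 * W\<^sup>2 * real d \<le> h * real D" using D(1) h by (simp add: field_simps)
    then have "W * real d * (80 * W) \<le> h * real D" by (simp add: power2_eq_square ac_simps)
    then show "W * (real d * (1 / real D)) \<le> e"
      using W D0 by (simp add: e_def field_simps)
    have "h \<le> 80 * W\<^sup>2" using h(2) zero_le_power2[of W] by linarith
    then have "h \<le> W * (80 * W)" by (simp add: power2_eq_square)
    then show "e \<le> W" using W by (simp add: e_def field_simps)
  qed
  obtain U where U: "finite U" "card U \<le> (2 * D + 1) ^ d" "U \<subseteq> carrier_vec d"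
    "\<And>v. v \<in> carrier_vec d \<Longrightarrow> vec_norm2 v \<le> 1 \<Longrightarrow>
      \<exists>u\<in>U. \<forall>p<d. \<bar>vec_index u p - vec_index v p\<bar> \<le> 1 / real D"
    using unit_ball_grid[OF D0] by blast
  define Q where "Q = (\<lambda>v. \<Sum>j\<in>B. (scalar_prod (x j) v)\<^sup>2)"
  \<comment> \<open>Only grid points near the level set enter the union bound: there the inner
    products are bounded and the mean excess is at least \<open>h / 2\<close>.\<close>
  define V where "V = {u \<in> U. (\<forall>j\<in>B. \<bar>scalar_prod (x j) u\<bar> \<le> 2 * W) \<and> real n * (h / 2) \<le> Q u}"
  define bad where "bad = (\<lambda>u. {xs. (\<Sum>j\<leftarrow>xs. excess x r B u j) \<le> real m * (Q u / real n) / 4})"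
  have sumQ: "(\<Sum>j<n. excess x r B v j) = Q v" if "v \<in> carrier_vec d" for v
    unfolding Q_def by (rule sum_excess[OF B orth[OF that]])
  have "?E \<inter> set_pmf ?p \<subseteq> (\<Union>u\<in>V. bad u)"
  proof
    fix xs assume "xs \<in> ?E \<inter> set_pmf ?p"
    then obtain v where v: "v \<in> carrier_vec d" "Q v = h * real n"
        "(\<Sum>j\<leftarrow>xs. excess x r B v j) \<le> 0" and len: "length xs = m"
      by (auto simp: Q_def set_replicate_pmf)
    have "h * real n * scalar_prod v v \<le> h * real n * 1"
      using strong[OF v(1)] v(2) by (simp add: Q_def)
    then have "scalar_prod v v \<le> 1" using h n by simp
    then have nv: "vec_norm2 v \<le> 1" by (simp add: vec_norm2_def)
    obtain u where u: "u \<in> U" "\<And>p. p < d \<Longrightarrow> \<bar>vec_index u p - vec_index v p\<bar> \<le> 1 / real D"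
      using U(4)[OF v(1) nv] by blast
    have uc: "u \<in> carrier_vec d" using u U by auto
    have close: "\<bar>scalar_prod (x j) u - scalar_prod (x j) v\<bar> \<le> e" if "j \<in> B" for j
    proof -
      have "\<bar>scalar_prod (x j) u - scalar_prod (x j) v\<bar> \<le> vec_norm2 (x j) * (real d * (1 / real D))"
        by (rule abs_scalar_prod_diff_le[OF x(1)[OF that] uc v(1) u(2)])
      also have "\<dots> \<le> W * (real d * (1 / real D))"
        using x(2)[OF that] by (intro mult_right_mono) auto
      finally show ?thesis using e(2) by simp
    qed
    have xv: "\<bar>scalar_prod (x j) v\<bar> \<le> W" if "j \<in> B" for j
    proof -
      have "\<bar>scalar_prod (x j) v\<bar> \<le> vec_norm2 (x j) * vec_norm2 v"
        by (rule abs_scalar_prod_le[OF x(1)[OF that] v(1)])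
      also have "\<dots> \<le> W * 1"
        using x(2)[OF that] nv W by (intro mult_mono) (auto simp: vec_norm2_def scalar_prod_self_nonneg)
      finally show ?thesis by simp
    qed
    have xu: "\<bar>scalar_prod (x j) u\<bar> \<le> 2 * W" if "j \<in> B" for j
      using close[OF that] xv[OF that] e(4) by linarith
    have diff: "\<bar>excess x r B u j - excess x r B v j\<bar> \<le> h / 16" for j
      unfolding e(3)[symmetric]
      by (rule abs_excess_diff_le) (use W e(1) close xu xv r in auto)
    have diff_le: "excess x r B v j - excess x r B u j \<le> h / 16" for j
      using diff[of j] by linarith
    \<comment> \<open>Summing the pointwise differences over the dataset compares the two quadratic
      forms: \<open>Q u\<close> loses at most \<open>n * h / 16\<close> against
      \<open>Q v = h * n\<close>.\<close>
    have "Q v - Q u \<le> (\<Sum>j<n. h / 16)"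
      unfolding sumQ[OF v(1), symmetric] sumQ[OF uc, symmetric] sum_subtractf[symmetric]
      by (intro sum_mono diff_le)
    moreover have "0 \<le> real n * h" using h by simp
    ultimately have Qu: "real n * (h / 2) \<le> Q u" using v(2) by (simp add: mult.commute)
    then have "u \<in> V" using u xu by (simp add: V_def)
    moreover have "xs \<in> bad u"
    proof -
      have "(\<Sum>j\<leftarrow>xs. excess x r B u j) \<le> (\<Sum>j\<leftarrow>xs. excess x r B v j + h / 16)"
      proof (intro sum_list_mono)
        show "excess x r B u j \<le> excess x r B v j + h / 16" for j
          using diff[of j] by linarith
      qed
      also have "\<dots> \<le> real m * (h / 16)"
        using v(3) len by (simp add: sum_list_addf sum_list_triv)
      also have "\<dots> \<le> real m * (Q u / real n / 4)"
      proof (intro mult_left_mono)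
        have "h / 2 \<le> Q u / real n" using Qu n by (simp add: field_simps)
        then have "h / 2 / 4 \<le> Q u / real n / 4" by (rule divide_right_mono) simp
        moreover have "h / 16 \<le> h / 2 / 4" using h(1) by simp
        ultimately show "h / 16 \<le> Q u / real n / 4" by (rule order_trans[rotated])
      qed simp
      finally show ?thesis by (simp add: bad_def)
    qed
    ultimately show "xs \<in> (\<Union>u\<in>V. bad u)" by blast
  qed
  then have "measure_pmf.prob ?p ?E \<le> measure_pmf.prob ?p (\<Union>u\<in>V. bad u)"
    by (subst measure_Int_set_pmf[symmetric]) (auto intro: measure_pmf.finite_measure_mono)
  also have "\<dots> \<le> (\<Sum>u\<in>V. measure_pmf.prob ?p (bad u))"
    using U(1) by (intro measure_pmf.finite_measure_subadditive_finite) (auto simp: V_def)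
  also have "\<dots> \<le> (\<Sum>u\<in>V. exp (- (real m * h / (256 * W\<^sup>2))))"
  proof (intro sum_mono)
    fix u assume "u \<in> V"
    then have u: "u \<in> carrier_vec d" "\<And>j. j \<in> B \<Longrightarrow> \<bar>scalar_prod (x j) u\<bar> \<le> 2 * W"
      "real n * (h / 2) \<le> Q u" using U(3) by (auto simp: V_def)
    let ?H = "Q u / real n"
    have W0: "0 \<le> W" using W by simp
    note bounds = square_excess_le[where x = x and r = r and B = B and v = u, OF W0 u(2) r]
    have "measure_pmf.prob ?p (bad u) \<le> exp (- (c * real m * ?H / 4))"
      unfolding bad_def
    proof (rule prob_uniform_lower_tail[OF n c(1)])
      fix j
      show "c * \<bar>excess x r B u j\<bar> \<le> 1"
        using mult_left_mono[OF bounds(2) c(1), of j] c(2) by simp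
    next
      show "(\<Sum>j<n. excess x r B u j) = real n * ?H" using sumQ[OF u(1)] n by simp
    next
      have "(\<Sum>j<n. (excess x r B u j)\<^sup>2)
          \<le> (\<Sum>j<n. if j \<in> B then 16 * W\<^sup>2 * (scalar_prod (x j) u)\<^sup>2 else 0)"
        by (intro sum_mono bounds(1))
      also have "\<dots> = 16 * W\<^sup>2 * Q u"
        using B by (subst sum.inter_restrict[symmetric])
          (auto simp: Int_absorb1 Q_def sum_distrib_left)
      finally have "2 * c * (\<Sum>j<n. (excess x r B u j)\<^sup>2) \<le> 2 * c * (16 * W\<^sup>2 * Q u)"
        using c(1) by (intro mult_left_mono) auto
      also have "\<dots> = 32 * (c * W\<^sup>2) * Q u" by simp
      also have "\<dots> = real n * ?H" unfolding c(2) using n by simp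
      finally show "2 * c * (\<Sum>j<n. (excess x r B u j)\<^sup>2) \<le> real n * ?H" .
    qed
    also have "\<dots> \<le> exp (- (real m * h / (256 * W\<^sup>2)))"
    proof -
      have "h / 2 \<le> ?H" using u(3) n by (simp add: field_simps)
      then have le: "c * real m * (h / 2) / 4 \<le> c * real m * ?H / 4"
        using c(1) by (intro divide_right_mono mult_left_mono) auto
      have "real m * h / (256 * W\<^sup>2) = c * real m * (h / 2) / 4"
        by (simp add: c_def)
      also note le
      finally show ?thesis by (simp only: exp_le_cancel_iff neg_le_iff_le)
    qed
    finally show "measure_pmf.prob ?p (bad u) \<le> exp (- (real m * h / (256 * W\<^sup>2)))" .
  qed
  also have "\<dots> = real (card V) * exp (- (real m * h / (256 * W\<^sup>2)))" by simp
  also have "\<dots> \<le> (400 * W\<^sup>2 * real d / h) ^ d * exp (- (real m * h / (256 * W\<^sup>2)))"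
  proof (intro mult_right_mono)
    have "card V \<le> card U" using U(1) by (intro card_mono) (auto simp: V_def)
    then have "real (card V) \<le> real ((2 * D + 1) ^ d)" using U(2) by linarith
    also have "\<dots> = (2 * real D + 1) ^ d" by (simp add: add.commute)
    \<comment> \<open>As \<open>ratio\<close> is at least 1, \<open>2 * D + 1\<close> is at most 160
      times the ratio plus 3, hence at most 400 times it.\<close>
    also have "\<dots> \<le> (400 * W\<^sup>2 * real d / h) ^ d"
      using D(2) ratio by (intro power_mono) auto
    finally show "real (card V) \<le> (400 * W\<^sup>2 * real d / h) ^ d" .
  qed simp
  finally show ?thesis .
qed

section \<open>Convexity of the empirical error and normal equations\<close>

lemma sum_mset_filter_if:
  fixes f :: "'a \<Rightarrow> 'b :: comm_monoid_add"
  shows "(\<Sum>j\<in>#A. if P j then f j else 0) = (\<Sum>j\<in>#filter_mset P A. f j)"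
  by (induction A) auto

lemma sum_mset_subtractf:
  fixes f g :: "'a \<Rightarrow> 'b :: ab_group_add"
  shows "(\<Sum>j\<in>#A. f j - g j) = (\<Sum>j\<in>#A. f j) - (\<Sum>j\<in>#A. g j)"
  by (induction A) auto

lemma residual_diff:
  assumes "x j \<in> carrier_vec d" "\<theta> \<in> carrier_vec d" "\<theta>' \<in> carrier_vec d"
  shows "residual x y \<theta>' j = residual x y \<theta> j - scalar_prod (x j) (\<theta>' - \<theta>)"
  using assms by (simp add: residual_def scalar_prod_minus_distrib[of _ d])

text \<open>
  By convexity the excess is at most linear along a ray, so positivity on the level set
  \<open>Q = h\<close> of the quadratic form confines the empirical minimizer to \<open>Q \<le> h\<close>.
\<close>

lemma ls_solution_in_level_set:
  fixes h :: real
  assumes h: "0 < h"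
    and x: "\<And>j. j \<in> B \<Longrightarrow> x j \<in> carrier_vec d"
    and \<theta>: "\<theta> \<in> carrier_vec d"
    and ls: "is_ls_solution d x y (filter_mset (\<lambda>j. j \<in> B) (mset xs)) \<theta>'"
    and pos: "\<And>v. v \<in> carrier_vec d \<Longrightarrow> (\<Sum>j\<in>B. (scalar_prod (x j) v)\<^sup>2) = h \<Longrightarrow>
      0 < (\<Sum>j\<leftarrow>xs. excess x (residual x y \<theta>) B v j)"
  shows "(\<Sum>j\<in>B. (scalar_prod (x j) (\<theta>' - \<theta>))\<^sup>2) \<le> h"
proof (rule ccontr)
  define v where "v = \<theta>' - \<theta>"
  define q where "q = (\<Sum>j\<in>B. (scalar_prod (x j) v)\<^sup>2)"
  let ?P = "filter_mset (\<lambda>j. j \<in> B) (mset xs)" and ?r = "residual x y \<theta>"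
  assume "\<not> ?thesis"
  then have q: "h < q" by (simp add: q_def v_def)
  have \<theta>': "\<theta>' \<in> carrier_vec d" and min: "ls_error x y ?P \<theta>' \<le> ls_error x y ?P \<theta>"
    using ls \<theta> by (auto simp: is_ls_solution_def is_arg_min_linorder)
  have v: "v \<in> carrier_vec d" using \<theta> \<theta>' by (simp add: v_def)
  \<comment> \<open>The factor that scales \<open>v\<close> back to the level set.\<close>
  define s where "s = sqrt (h / q)"
  have s: "0 \<le> s" "s \<le> 1" "s\<^sup>2 * q = h" using h q by (auto simp: s_def)
  have sx: "scalar_prod (x j) (s \<cdot>\<^sub>v v) = s * scalar_prod (x j) v" if "j \<in> B" for j
    using x[OF that] v by simp
  have "(\<Sum>j\<in>B. (scalar_prod (x j) (s \<cdot>\<^sub>v v))\<^sup>2) = s\<^sup>2 * q"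
    by (simp add: sx power_mult_distrib q_def sum_distrib_left)
  then have "0 < (\<Sum>j\<leftarrow>xs. excess x ?r B (s \<cdot>\<^sub>v v) j)"
    using v s(3) by (intro pos) auto
  also have "\<dots> \<le> (\<Sum>j\<leftarrow>xs. s * excess x ?r B v j)"
  proof (intro sum_list_mono)
    fix j
    \<comment> \<open>Since \<open>s \<le> 1\<close>, the quadratic part shrinks at least as much as
      the linear part.\<close>
    have "s * s * (scalar_prod (x j) v)\<^sup>2 \<le> s * 1 * (scalar_prod (x j) v)\<^sup>2"
      using s by (intro mult_right_mono mult_left_mono) auto
    then show "excess x ?r B (s \<cdot>\<^sub>v v) j \<le> s * excess x ?r B v j"
      by (simp add: excess_def sx power_mult_distrib right_diff_distrib power2_eq_square ac_simps)
  qed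
  also have "\<dots> = s * (\<Sum>j\<leftarrow>xs. excess x ?r B v j)" by (rule sum_list_const_mult)
  also have "(\<Sum>j\<leftarrow>xs. excess x ?r B v j) = (\<Sum>j\<in>#mset xs. excess x ?r B v j)"
    by (metis mset_map sum_mset_sum_list)
  also have "\<dots> = (\<Sum>j\<in>#?P. (scalar_prod (x j) v)\<^sup>2 - 2 * ?r j * scalar_prod (x j) v)"
    unfolding excess_def by (rule sum_mset_filter_if)
  also have "\<dots> = (\<Sum>j\<in>#?P. (residual x y \<theta>' j)\<^sup>2 - (?r j)\<^sup>2)"
  proof (intro arg_cong[where f = sum_mset] image_mset_cong)
    fix j assume "j \<in># ?P"
    then have "j \<in> B" by simp
    have "residual x y \<theta>' j = ?r j - scalar_prod (x j) v"
      unfolding v_def by (rule residual_diff[where d = d]) (use x[OF \<open>j \<in> B\<close>] \<theta> \<theta>' in auto)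
    then show "(scalar_prod (x j) v)\<^sup>2 - 2 * ?r j * scalar_prod (x j) v = (residual x y \<theta>' j)\<^sup>2 - (?r j)\<^sup>2"
      by (simp add: power2_diff)
  qed
  also have "\<dots> = ls_error x y ?P \<theta>' - ls_error x y ?P \<theta>"
    unfolding ls_error_def by (rule sum_mset_subtractf)
  finally have "0 < s * (ls_error x y ?P \<theta>' - ls_error x y ?P \<theta>)" .
  then show False using min s(1) by (simp add: zero_less_mult_iff)
qed

text \<open>First-order condition for the squared error along the line from \<open>\<theta>\<close>
  in direction \<open>v\<close>.\<close>

lemma ls_normal_equation:
  assumes B: "finite B" "\<And>j. j \<in> B \<Longrightarrow> x j \<in> carrier_vec d"
    and ls: "is_ls_solution d x y (mset_set B) \<theta>" and v: "v \<in> carrier_vec d"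
  shows "(\<Sum>j\<in>B. residual x y \<theta> j * scalar_prod (x j) v) = 0"
proof (rule linear_coefficient_eq_0)
  fix t :: real
  have \<theta>: "\<theta> \<in> carrier_vec d" using ls by (simp add: is_ls_solution_def is_arg_min_linorder)
  have "ls_error x y (mset_set B) \<theta> \<le> ls_error x y (mset_set B) (\<theta> + t \<cdot>\<^sub>v v)"
    using ls v \<theta> by (simp add: is_ls_solution_def is_arg_min_linorder)
  moreover have "residual x y (\<theta> + t \<cdot>\<^sub>v v) j = residual x y \<theta> j - t * scalar_prod (x j) v"
    if "j \<in> B" for j
    unfolding residual_def using scalar_prod_add_smult[OF B(2)[OF that] \<theta> v] by simp
  ultimately have "(\<Sum>j\<in>B. (residual x y \<theta> j)\<^sup>2)
      \<le> (\<Sum>j\<in>B. (residual x y \<theta> j - t * scalar_prod (x j) v)\<^sup>2)"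
    by (simp add: ls_error_def sum_unfold_sum_mset[symmetric] cong: sum.cong)
  then show "0 \<le> t\<^sup>2 * (\<Sum>j\<in>B. (scalar_prod (x j) v)\<^sup>2)
      - 2 * t * (\<Sum>j\<in>B. residual x y \<theta> j * scalar_prod (x j) v)"
    by (simp add: power2_diff power_mult_distrib sum.distrib sum_subtractf sum_distrib_left ac_simps)
qed

subsection \<open>Loss of the output\<close>

lemma ls_error_mset_set: "ls_error x y (mset_set S) \<theta> = (\<Sum>j\<in>S. (residual x y \<theta> j)\<^sup>2)"
  by (simp add: ls_error_def sum_unfold_sum_mset)

lemma is_partition_subset: "is_partition n k Q \<Longrightarrow> i < k \<Longrightarrow> Q i \<subseteq> {..<n}"
  unfolding is_partition_def by blast

lemma sum_partition:
  assumes "is_partition n k Q"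
  shows "(\<Sum>j<n. f j) = (\<Sum>i<k. \<Sum>j\<in>Q i. f j)"
proof -
  have "finite (Q i)" if "i < k" for i
    using is_partition_subset[OF assms that] finite_subset by blast
  then have "sum f (\<Union>i<k. Q i) = (\<Sum>i<k. sum f (Q i))"
    using assms by (intro sum.UNION_disjoint_family) (auto simp: is_partition_def)
  then show ?thesis using assms by (simp add: is_partition_def)
qed

text \<open>The pointwise minimum is at most the error of any assigned parameter. The map
  \<open>\<sigma>\<close> lets a small cluster be served by the parameter of another one.\<close>

lemma min_loss_le_assignment:
  assumes Q: "is_partition n k Q" and \<sigma>: "\<And>i. i < k \<Longrightarrow> \<sigma> i < k"
  shows "min_loss n k x y \<theta> \<le> (\<Sum>i<k. ls_error x y (mset_set (Q i)) (\<theta> (\<sigma> i))) / real n"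
  unfolding min_loss_def sum_partition[OF Q] ls_error_mset_set
  using \<sigma> by (intro divide_right_mono sum_mono Min_le) auto

text \<open>A nearest partition attains the minimum at every sample, so the objective compared by
  the algorithm is the loss itself.\<close>

lemma min_loss_nearest_partition:
  assumes "is_nearest_partition n k x y \<theta> Q"
  shows "min_loss n k x y \<theta> = (\<Sum>i<k. ls_error x y (mset_set (Q i)) (\<theta> i)) / real n"
proof -
  have "Min ((\<lambda>j. (residual x y (\<theta> j) i)\<^sup>2) ` {..<k}) = (residual x y (\<theta> l) i)\<^sup>2"
    if "l < k" "i \<in> Q l" for l i
    using assms that
    by (intro Min_eqI) (auto simp: is_nearest_partition_def is_arg_min_linorder)
  moreover have "is_partition n k Q" using assms by (simp add: is_nearest_partition_def)
  ultimately show ?thesis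
    unfolding min_loss_def ls_error_mset_set
    by (subst sum_partition) (auto intro!: arg_cong2[where f = "(/)"] sum.cong)
qed

text \<open>Reduces the analysis to a single, freely chosen partition \<open>P\<close> of the
  sub-sample: refitting does not increase the loss of the selected parameters, and these were
  selected as best among all partitions.\<close>

lemma subsampling_output_improves:
  assumes out: "subsampling_output d n k x y A \<theta>p" and P: "is_mset_partition k A P"
  obtains \<Theta> where "\<And>i. i < k \<Longrightarrow> is_ls_solution d x y (P i) (\<Theta> i)"
    "min_loss n k x y \<theta>p \<le> min_loss n k x y \<Theta>"
proof -
  obtain \<Theta> Q P0 where ls: "\<And>P' i. is_mset_partition k A P' \<Longrightarrow> i < k \<Longrightarrow> is_ls_solution d x y (P' i) (\<Theta> P' i)"
    and nearest: "\<And>P'. is_mset_partition k A P' \<Longrightarrow> is_nearest_partition n k x y (\<Theta> P') (Q P')"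
    and P0: "is_arg_min (\<lambda>P'. (\<Sum>i<k. ls_error x y (mset_set (Q P' i)) (\<Theta> P' i)) / real n)
      (is_mset_partition k A) P0"
    and \<theta>p: "\<And>i. i < k \<Longrightarrow> is_ls_solution d x y (mset_set (Q P0 i)) (\<theta>p i)"
    using out unfolding subsampling_output_def by blast
  have P0': "is_mset_partition k A P0" using P0 by (simp add: is_arg_min_def)
  have "min_loss n k x y \<theta>p \<le> (\<Sum>i<k. ls_error x y (mset_set (Q P0 i)) (\<theta>p i)) / real n"
    using nearest[OF P0'] by (intro min_loss_le_assignment) (auto simp: is_nearest_partition_def)
  also have "\<dots> \<le> (\<Sum>i<k. ls_error x y (mset_set (Q P0 i)) (\<Theta> P0 i)) / real n"
    using \<theta>p ls[OF P0']
    by (intro divide_right_mono sum_mono) (auto simp: is_ls_solution_def is_arg_min_linorder)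
  also have "\<dots> \<le> (\<Sum>i<k. ls_error x y (mset_set (Q P i)) (\<Theta> P i)) / real n"
    using P0 P by (simp add: is_arg_min_linorder)
  also have "\<dots> = min_loss n k x y (\<Theta> P)"
    by (rule min_loss_nearest_partition[OF nearest[OF P], symmetric])
  finally show ?thesis using that ls[OF P] by blast
qed

lemma subsampling_output_le_zero_loss:
  assumes out: "subsampling_output d n k x y A \<theta>p" and n: "1 \<le> n"
    and x: "\<And>j. j < n \<Longrightarrow> x j \<in> carrier_vec d" and y: "\<And>j. j < n \<Longrightarrow> \<bar>y j\<bar> \<le> W"
  shows "min_loss n k x y \<theta>p \<le> W\<^sup>2"
proof -
  obtain \<Theta> Q where nearest: "is_nearest_partition n k x y \<Theta> Q"
    and \<theta>p: "\<And>i. i < k \<Longrightarrow> is_ls_solution d x y (mset_set (Q i)) (\<theta>p i)"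
    using out unfolding subsampling_output_def is_arg_min_def by blast
  have Q: "is_partition n k Q" using nearest by (simp add: is_nearest_partition_def)
  have "min_loss n k x y \<theta>p \<le> (\<Sum>i<k. ls_error x y (mset_set (Q i)) (\<theta>p i)) / real n"
    by (rule min_loss_le_assignment[OF Q])
  also have "\<dots> \<le> (\<Sum>i<k. ls_error x y (mset_set (Q i)) (0\<^sub>v d)) / real n"
    using \<theta>p by (intro divide_right_mono sum_mono) (auto simp: is_ls_solution_def is_arg_min_linorder)
  also have "\<dots> = (\<Sum>j<n. (residual x y (0\<^sub>v d) j)\<^sup>2) / real n"
    by (simp add: ls_error_mset_set sum_partition[OF Q])
  also have "\<dots> \<le> (\<Sum>j<n. W\<^sup>2) / real n"
  proof (intro divide_right_mono sum_mono)
    fix j assume "j \<in> {..<n}"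
    then have "residual x y (0\<^sub>v d) j = y j" "\<bar>y j\<bar> \<le> W"
      using x[of j] y[of j] by (auto simp: residual_def)
    then show "(residual x y (0\<^sub>v d) j)\<^sup>2 \<le> W\<^sup>2"
      using power_mono[of "\<bar>y j\<bar>" W 2] by simp
  qed simp
  also have "\<dots> = W\<^sup>2" using n by simp
  finally show ?thesis .
qed

text \<open>Every drawn index lies in exactly one cluster, so multiplicities add up; the empty
  default beyond \<open>k\<close> is the normalization built into
  \<open>is_mset_partition\<close>.\<close>

lemma is_mset_partition_filter:
  assumes "is_partition n k B" "set_mset A \<subseteq> {..<n}"
  shows "is_mset_partition k A (\<lambda>i. if i < k then filter_mset (\<lambda>j. j \<in> B i) A else {#})"
proof -
  have "(\<Sum>i<k. filter_mset (\<lambda>j. j \<in> B i) A) = A"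
  proof (rule multiset_eqI)
    fix j
    have count: "count (\<Sum>i<k. filter_mset (\<lambda>j. j \<in> B i) A) j = (\<Sum>i<k. if j \<in> B i then count A j else 0)"
      by (simp add: count_sum)
    show "count (\<Sum>i<k. filter_mset (\<lambda>j. j \<in> B i) A) j = count A j"
    proof (cases "j \<in># A")
      case True
      then obtain l where l: "l < k" "j \<in> B l" using assms by (auto simp: is_partition_def)
      have "j \<in> B i \<longleftrightarrow> i = l" if "i < k" for i
        using assms(1) l that unfolding is_partition_def disjoint_family_on_def by blast
      then have "(\<Sum>i<k. if j \<in> B i then count A j else 0) = (\<Sum>i<k. if i = l then count A j else 0)"
        by (intro sum.cong) auto
      then show ?thesis using l count by (simp add: sum.delta)
    next
      case False
      then show ?thesis unfolding count by (simp add: not_in_iff)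
    qed
  qed
  then show ?thesis by (simp add: is_mset_partition_def)
qed

text \<open>Pythagoras: the cross term vanishes by the normal equations.\<close>

lemma ls_error_eq_add:
  assumes B: "finite B" "\<And>j. j \<in> B \<Longrightarrow> x j \<in> carrier_vec d"
    and ls: "is_ls_solution d x y (mset_set B) \<theta>" and \<theta>': "\<theta>' \<in> carrier_vec d"
  shows "ls_error x y (mset_set B) \<theta>' =
    ls_error x y (mset_set B) \<theta> + (\<Sum>j\<in>B. (scalar_prod (x j) (\<theta>' - \<theta>))\<^sup>2)"
proof -
  have \<theta>: "\<theta> \<in> carrier_vec d" using ls by (simp add: is_ls_solution_def is_arg_min_def)
  have "(\<Sum>j\<in>B. (residual x y \<theta>' j)\<^sup>2) =
      (\<Sum>j\<in>B. (residual x y \<theta> j - scalar_prod (x j) (\<theta>' - \<theta>))\<^sup>2)"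
    using residual_diff[OF B(2) \<theta> \<theta>'] by (intro sum.cong) auto
  also have "\<dots> = (\<Sum>j\<in>B. (residual x y \<theta> j)\<^sup>2) + (\<Sum>j\<in>B. (scalar_prod (x j) (\<theta>' - \<theta>))\<^sup>2)
      - 2 * (\<Sum>j\<in>B. residual x y \<theta> j * scalar_prod (x j) (\<theta>' - \<theta>))"
    by (simp add: power2_diff sum.distrib sum_subtractf sum_distrib_left mult.assoc)
  also have "(\<Sum>j\<in>B. residual x y \<theta> j * scalar_prod (x j) (\<theta>' - \<theta>)) = 0"
    using \<theta> \<theta>' by (intro ls_normal_equation[OF B ls]) auto
  finally show ?thesis by (simp add: ls_error_mset_set)
qed

section \<open>Large clusters, sample size, and the final union bound\<close>

lemma ex_large_part:
  assumes "is_partition n k B" "1 \<le> n"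
  obtains i where "i < k" "1 / real k \<le> real (card (B i)) / real n"
proof -
  have n: "(\<Sum>i<k. real (card (B i))) = real n"
    using sum_partition[OF assms(1), of "\<lambda>_. 1 :: real"] by simp
  then have k: "0 < k" using assms(2) by (intro gr0I) auto
  have "\<exists>i<k. real n / real k \<le> real (card (B i))"
  proof (rule ccontr)
    assume "\<not> ?thesis"
    then have "(\<Sum>i<k. real (card (B i))) < (\<Sum>i<k. real n / real k)"
      using k by (intro sum_strict_mono) (auto simp: not_le lessThan_empty_iff)
    then show False using n k by simp
  qed
  then obtain i where "i < k" "real n / real k \<le> real (card (B i))" by blast
  then show ?thesis using k assms(2) by (intro that[of i]) (auto simp: field_simps)
qed

text \<open>After taking logarithms the claim is
  \<open>d * T + ln (k / \<delta>) \<le> m * h / (256 * W\<^sup>2)\<close>, where \<open>T\<close>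
  is the logarithm of the base of the grid bound. The single log factor of the rate absorbs
  \<open>T\<close>.\<close>

lemma sample_size_union_bound:
  fixes W h :: real
  assumes "1 \<le> d" "1 \<le> k" and pos: "0 < \<alpha>" "0 < lmin" "0 < \<epsilon>" and \<delta>: "0 < \<delta>" "\<delta> < 1" and W: "1 \<le> W"
    and h: "h = \<epsilon> * lmin / (real k * W\<^sup>2)"
    and m: "enough_samples (256 * W ^ 4 * (ln (400 * W ^ 4) + 4)) 1 k d \<alpha> lmin \<epsilon> \<delta> m"
  shows "real k * ((400 * W\<^sup>2 * real d / h) ^ d * exp (- (real m * h / (256 * W\<^sup>2)))) \<le> \<delta>"
proof -
  define E where "E = exp 1 + real k + real d + 1 / \<alpha> + 1 / lmin + 1 / \<epsilon> + 1 / \<delta>"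
  define L where "L = ln E"
  define S where "S = real d + ln (real k / \<delta>)"
  define G where "G = ln (400 * W ^ 4) + 4"
  define T where "T = ln (400 * W\<^sup>2 * real d / h)"
  have k: "1 \<le> real k" and d: "1 \<le> real d" using assms by auto
  have hpos: "0 < h" using pos k W unfolding h by simp
  have W4: "1 \<le> W ^ 4" using W by simp
  have inv: "0 < 1 / \<alpha>" "0 < 1 / lmin" "0 < 1 / \<epsilon>" "0 < 1 / \<delta>" using pos \<delta> by auto
  have e1: "1 \<le> exp (1::real)" by simp
  have E: "exp 1 \<le> E" "real k \<le> E" "real d \<le> E" "1 / lmin \<le> E" "1 / \<epsilon> \<le> E" "1 \<le> E"
    using inv k d e1 unfolding E_def by linarith+
  have L: "1 \<le> L" unfolding L_def using E(1,6) by (subst ln_ge_iff) auto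
  have lnW: "0 \<le> ln (400 * W ^ 4)" using W4 by (intro ln_ge_zero) linarith
  \<comment> \<open>Inserting \<open>h\<close> exhibits four factors, each at most \<open>E\<close>;
    this is the source of \<open>4 * L\<close> and of the summand 4 in the constant.\<close>
  have N: "400 * W\<^sup>2 * real d / h = 400 * W ^ 4 * (real d * real k * (1 / lmin) * (1 / \<epsilon>))"
    using pos W k unfolding h by (simp add: field_simps power2_eq_square power4_eq_xxxx)
  have "real d * real k * (1 / lmin) * (1 / \<epsilon>) \<le> E * E * E * E"
    using E inv by (intro mult_mono mult_nonneg_nonneg) auto
  also have "\<dots> = E ^ 4" by (simp add: power4_eq_xxxx)
  finally have "400 * W\<^sup>2 * real d / h \<le> 400 * W ^ 4 * E ^ 4"
    unfolding N using W4 by (intro mult_left_mono) auto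
  moreover have Npos: "0 < 400 * W\<^sup>2 * real d / h" using hpos W d by simp
  ultimately have "T \<le> ln (400 * W ^ 4 * E ^ 4)" unfolding T_def by (intro ln_mono) auto
  also have "\<dots> = ln (400 * W ^ 4) + 4 * L"
    using W4 E(6) by (subst ln_mult_pos) (auto simp: L_def ln_realpow)
  also have "\<dots> \<le> ln (400 * W ^ 4) * L + 4 * L"
    using mult_left_mono[OF L lnW] by simp
  finally have T: "T \<le> G * L" by (simp add: G_def distrib_right)
  have lnk: "0 \<le> ln (real k / \<delta>)" using k \<delta> by (intro ln_ge_zero) (simp add: field_simps)
  have GL: "1 \<le> G * L" using mult_mono[of 1 G 1 L] L lnW by (simp add: G_def)
  \<comment> \<open>Replacing the maximum by \<open>\<epsilon> / k\<close> cancels one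
    \<open>k\<close> and one \<open>\<epsilon>\<close> of the rate.\<close>
  have "real k / (\<epsilon> * lmin) * S \<le> sample_rate k d (max \<alpha> (\<epsilon> / real k)) lmin \<epsilon> \<delta>"
  proof -
    have "real k / (\<epsilon> * lmin) * S = 1 / \<epsilon>\<^sup>2 * (real k)\<^sup>2 * (\<epsilon> / real k / lmin) * S"
      using pos k by (simp add: power2_eq_square)
    also have "\<dots> \<le> 1 / \<epsilon>\<^sup>2 * (real k)\<^sup>2 * (max \<alpha> (\<epsilon> / real k) / lmin) * S"
      using pos lnk by (intro mult_right_mono mult_left_mono divide_right_mono) (auto simp: S_def)
    finally show ?thesis by (simp add: sample_rate_def S_def)
  qed
  then have "256 * W ^ 4 * G * L * (real k / (\<epsilon> * lmin) * S)
      \<le> 256 * W ^ 4 * G * L * sample_rate k d (max \<alpha> (\<epsilon> / real k)) lmin \<epsilon> \<delta>"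
    using L lnW W4 by (intro mult_left_mono) (auto simp: G_def)
  also have "\<dots> \<le> real m"
    using m by (simp add: enough_samples_def log_factor_def E_def L_def G_def ac_simps)
  finally have "256 * W ^ 4 * G * L * (real k / (\<epsilon> * lmin) * S) \<le> real m" .
  then have "256 * W ^ 4 * G * L * (real k / (\<epsilon> * lmin) * S) * (h / (256 * W\<^sup>2)) \<le> real m * (h / (256 * W\<^sup>2))"
    using hpos by (intro mult_right_mono) auto
  \<comment> \<open>The factor \<open>W ^ 4\<close> of the constant compensates one
    \<open>W\<^sup>2\<close> from \<open>h\<close> and one from the tail exponent.\<close>
  also have "256 * W ^ 4 * G * L * (real k / (\<epsilon> * lmin) * S) * (h / (256 * W\<^sup>2)) = G * L * S"
    using pos W k unfolding h by (simp add: field_simps power2_eq_square power4_eq_xxxx)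
  finally have "G * L * S \<le> real m * h / (256 * W\<^sup>2)" by simp
  moreover have "real d * T + ln (real k / \<delta>) \<le> G * L * S"
  proof -
    have "real d * T \<le> G * L * real d" using mult_left_mono[OF T, of "real d"] by (simp add: ac_simps)
    moreover have "ln (real k / \<delta>) \<le> G * L * ln (real k / \<delta>)"
      using mult_right_mono[OF GL lnk] by simp
    ultimately show ?thesis by (simp add: S_def distrib_left)
  qed
  ultimately have X: "real d * T + ln (real k / \<delta>) - real m * h / (256 * W\<^sup>2) \<le> 0" by linarith
  have "(400 * W\<^sup>2 * real d / h) ^ d = exp (real d * T)"
    using Npos by (simp add: T_def exp_of_nat_mult)
  moreover have "real k = \<delta> * exp (ln (real k / \<delta>))" using k \<delta> by simp
  ultimately have "real k * ((400 * W\<^sup>2 * real d / h) ^ d * exp (- (real m * h / (256 * W\<^sup>2)))) =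
      \<delta> * exp (ln (real k / \<delta>)) * (exp (real d * T) * exp (- (real m * h / (256 * W\<^sup>2))))"
    by metis
  also have "\<dots> = \<delta> * exp (real d * T + ln (real k / \<delta>) - real m * h / (256 * W\<^sup>2))"
    by (simp add: exp_add exp_diff exp_minus field_simps)
  also have "\<dots> \<le> \<delta> * 1" using X \<delta> by (intro mult_left_mono) auto
  finally show ?thesis by simp
qed

text \<open>Each cluster may lose \<open>n * \<epsilon> / k\<close> in squared error. A cluster in
  \<open>I\<close> keeps its own parameter and pays the quadratic form; every other cluster is small
  enough to use the parameter of \<open>i0\<close>.\<close>

lemma min_loss_near_optimal:
  fixes W h \<epsilon> :: real
  assumes n: "1 \<le> n" and k: "1 \<le> k"
    and x: "\<And>j. j < n \<Longrightarrow> x j \<in> carrier_vec d"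
    and opt: "is_optimal d n k x y B \<theta>"
    and \<Theta>: "\<And>i. i < k \<Longrightarrow> \<Theta> i \<in> carrier_vec d"
    and I: "i0 \<in> I" "I \<subseteq> {..<k}"
    and large: "\<And>i. i \<in> I \<Longrightarrow> (\<Sum>j\<in>B i. (scalar_prod (x j) (\<Theta> i - \<theta> i))\<^sup>2) \<le> real n * (\<epsilon> / real k)"
    and small: "\<And>i. i < k \<Longrightarrow> i \<notin> I \<Longrightarrow> real (card (B i)) * W\<^sup>2 \<le> real n * (\<epsilon> / real k)"
    and W: "\<And>j. j < n \<Longrightarrow> \<bar>residual x y (\<Theta> i0) j\<bar> \<le> W"
  shows "min_loss n k x y \<Theta> \<le> min_loss n k x y \<theta> + \<epsilon>"
proof -
  have nearest: "is_nearest_partition n k x y \<theta> B" and part: "is_partition n k B"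
    using opt by (auto simp: is_optimal_def is_nearest_partition_def)
  have B: "B i \<subseteq> {..<n}" if "i < k" for i by (rule is_partition_subset[OF part that])
  define \<sigma> where "\<sigma> = (\<lambda>i. if i \<in> I then i else i0)"
  have "ls_error x y (mset_set (B i)) (\<Theta> (\<sigma> i))
      \<le> ls_error x y (mset_set (B i)) (\<theta> i) + real n * (\<epsilon> / real k)" if i: "i < k" for i
  proof (cases "i \<in> I")
    case True
    have "ls_error x y (mset_set (B i)) (\<Theta> i) =
        ls_error x y (mset_set (B i)) (\<theta> i) + (\<Sum>j\<in>B i. (scalar_prod (x j) (\<Theta> i - \<theta> i))\<^sup>2)"
    proof (rule ls_error_eq_add[OF _ _ _ \<Theta>[OF i]])
      show "finite (B i)" using B[OF i] finite_subset by blast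
      show "x j \<in> carrier_vec d" if "j \<in> B i" for j using that B[OF i] x by auto
      show "is_ls_solution d x y (mset_set (B i)) (\<theta> i)" using opt i by (simp add: is_optimal_def)
    qed
    then show ?thesis using large[OF True] True by (simp add: \<sigma>_def)
  next
    case False
    have "ls_error x y (mset_set (B i)) (\<Theta> i0) \<le> (\<Sum>j\<in>B i. W\<^sup>2)"
      unfolding ls_error_mset_set
    proof (intro sum_mono)
      fix j assume "j \<in> B i"
      then show "(residual x y (\<Theta> i0) j)\<^sup>2 \<le> W\<^sup>2"
        using power_mono[OF W[of j], of 2] B[OF i] by auto
    qed
    also have "\<dots> \<le> real n * (\<epsilon> / real k)" using small[OF i False] by simp
    also have "\<dots> \<le> ls_error x y (mset_set (B i)) (\<theta> i) + real n * (\<epsilon> / real k)"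
      by (simp add: ls_error_mset_set sum_nonneg)
    finally show ?thesis using False by (simp add: \<sigma>_def)
  qed
  then have "(\<Sum>i<k. ls_error x y (mset_set (B i)) (\<Theta> (\<sigma> i)))
      \<le> (\<Sum>i<k. ls_error x y (mset_set (B i)) (\<theta> i) + real n * (\<epsilon> / real k))"
    by (intro sum_mono) auto
  also have "\<dots> = (\<Sum>i<k. ls_error x y (mset_set (B i)) (\<theta> i)) + real n * \<epsilon>"
    using k by (simp add: sum.distrib)
  finally have le: "(\<Sum>i<k. ls_error x y (mset_set (B i)) (\<Theta> (\<sigma> i)))
      \<le> (\<Sum>i<k. ls_error x y (mset_set (B i)) (\<theta> i)) + real n * \<epsilon>" .
  have "min_loss n k x y \<Theta> \<le> (\<Sum>i<k. ls_error x y (mset_set (B i)) (\<Theta> (\<sigma> i))) / real n"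
    using I by (intro min_loss_le_assignment[OF part]) (auto simp: \<sigma>_def)
  also have "\<dots> \<le> ((\<Sum>i<k. ls_error x y (mset_set (B i)) (\<theta> i)) + real n * \<epsilon>) / real n"
    using le by (intro divide_right_mono) auto
  also have "\<dots> = min_loss n k x y \<theta> + \<epsilon>"
    unfolding min_loss_nearest_partition[OF nearest] using n by (simp add: add_divide_distrib)
  finally show ?thesis .
qed

lemma prob_subsampling_near_optimal:
  fixes W \<alpha> lmin \<epsilon> \<delta> :: real
  assumes d: "1 \<le> d" and n: "1 \<le> n" and k: "1 \<le> k"
    and x: "\<And>j. j < n \<Longrightarrow> x j \<in> carrier_vec d"
    and opt: "is_optimal d n k x y B \<theta>"
    and pos: "0 < \<alpha>" "0 < lmin" "0 < \<epsilon>" and \<delta>: "0 < \<delta>" "\<delta> < 1"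
    and lmin: "\<And>i. i < k \<Longrightarrow> lmin \<le> min_eigenvalue (second_moment d x (B i))"
    and W: "1 \<le> W"
    and bounds: "\<And>j. j < n \<Longrightarrow> \<bar>y j\<bar> \<le> W" "\<And>j. j < n \<Longrightarrow> vec_norm2 (x j) \<le> W"
    and near: "\<And>i j v. i < k \<Longrightarrow> j < n \<Longrightarrow> v \<in> carrier_vec d \<Longrightarrow> vec_norm2 (v - \<theta> i) \<le> 1 \<Longrightarrow>
      \<bar>residual x y v j\<bar> \<le> W"
    and m: "enough_samples (256 * W ^ 4 * (ln (400 * W ^ 4) + 4)) 1 k d \<alpha> lmin \<epsilon> \<delta> m"
  shows "1 - \<delta> \<le> measure_pmf.prob (subsample n m)
    {A. \<forall>\<theta>p. subsampling_output d n k x y A \<theta>p \<longrightarrow>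
      min_loss n k x y \<theta>p \<le> min_loss n k x y \<theta> + \<epsilon>}" (is "_ \<le> measure_pmf.prob _ ?G")
proof (cases "W\<^sup>2 \<le> \<epsilon>")
  case True
  have "0 \<le> min_loss n k x y \<theta>"
    unfolding min_loss_def using k
    by (intro divide_nonneg_nonneg sum_nonneg Min.boundedI) (auto simp: lessThan_empty_iff)
  then have "?G = UNIV"
    using True subsampling_output_le_zero_loss[OF _ n x bounds(1)] by fastforce
  then show ?thesis using \<delta> by simp
next
  case False
  then have \<epsilon>W: "\<epsilon> \<le> W\<^sup>2" by simp
  let ?p = "replicate_pmf m (pmf_of_set {..<n})"
  define h where "h = \<epsilon> * lmin / (real k * W\<^sup>2)"
  define I where "I = {i. i < k \<and> \<epsilon> / (real k * W\<^sup>2) \<le> real (card (B i)) / real n}"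
  have part: "is_partition n k B" using opt by (simp add: is_optimal_def is_nearest_partition_def)
  have B: "B i \<subseteq> {..<n}" if "i < k" for i by (rule is_partition_subset[OF part that])
  have fin: "finite (B i)" if "i < k" for i using B[OF that] finite_subset by blast
  have xB: "x j \<in> carrier_vec d" if "i < k" "j \<in> B i" for i j using that B x by blast
  have \<theta>: "\<theta> i \<in> carrier_vec d" and ls: "is_ls_solution d x y (mset_set (B i)) (\<theta> i)" if "i < k" for i
    using opt that by (auto simp: is_optimal_def is_arg_min_linorder)
  have W2: "0 < W\<^sup>2" using W by simp
  obtain i0 where i0: "i0 < k" "1 / real k \<le> real (card (B i0)) / real n"
    using ex_large_part[OF part n] by blast
  have "\<epsilon> / (real k * W\<^sup>2) \<le> 1 / real k" using \<epsilon>W W2 k by (simp add: field_simps)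
  \<comment> \<open>A cluster of at least average mass counts as large because
    \<open>\<epsilon> \<le> W\<^sup>2\<close>; its parameter will serve the small clusters.\<close>
  then have i0I: "i0 \<in> I" using i0 by (simp add: I_def)
  have lower: "lmin * real (card (B i)) * scalar_prod v v \<le> (\<Sum>j\<in>B i. (scalar_prod (x j) v)\<^sup>2)"
    if "i < k" "v \<in> carrier_vec d" for i v
    by (rule second_moment_lower_bound[OF d fin[OF that(1)] xB[OF that(1)] that(2) lmin[OF that(1)]])
  \<comment> \<open>Testing the quadratic form on a unit vector bounds \<open>lmin\<close> by the
    squared data norm. This makes \<open>h\<close> at most \<open>\<epsilon> / k\<close>, the loss
    allowed per cluster.\<close>
  have "lmin \<le> W\<^sup>2"
  proof -
    let ?e = "unit_vec d 0 :: real vec"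
    have e: "scalar_prod ?e ?e = 1" using d by simp
    have "lmin * real (card (B i0)) \<le> (\<Sum>j\<in>B i0. (scalar_prod (x j) ?e)\<^sup>2)"
      using lower[OF i0(1), of ?e] unfolding e by simp
    also have "\<dots> \<le> (\<Sum>j\<in>B i0. W\<^sup>2)"
    proof (intro sum_mono)
      fix j assume j: "j \<in> B i0"
      have "\<bar>scalar_prod (x j) ?e\<bar> \<le> vec_norm2 (x j)"
        using abs_scalar_prod_le[OF xB[OF i0(1) j], of ?e] e by (simp add: vec_norm2_def)
      also have "\<dots> \<le> W" using j B[OF i0(1)] bounds(2) by auto
      finally show "(scalar_prod (x j) ?e)\<^sup>2 \<le> W\<^sup>2"
        using power_mono[of "\<bar>scalar_prod (x j) ?e\<bar>" W 2] by simp
    qed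
    finally have "lmin * real (card (B i0)) \<le> W\<^sup>2 * real (card (B i0))" by (simp add: mult.commute)
    moreover have "0 < real (card (B i0))"
    proof -
      have "0 < 1 / real k" using k by simp
      then have "0 < real (card (B i0)) / real n" using i0(2) by linarith
      then show ?thesis using n by (simp add: zero_less_divide_iff)
    qed
    ultimately show ?thesis by simp
  qed
  then have h: "0 < h" "h \<le> W\<^sup>2" "h \<le> \<epsilon> / real k"
  proof -
    show "0 < h" using pos W2 k by (simp add: h_def)
    have "h = \<epsilon> / real k * (lmin / W\<^sup>2)" by (simp add: h_def)
    also have "\<dots> \<le> \<epsilon> / real k * 1"
      using \<open>lmin \<le> W\<^sup>2\<close> W2 pos by (intro mult_left_mono) auto
    finally show "h \<le> \<epsilon> / real k" by simp
    also have "\<dots> \<le> \<epsilon> / 1" using k pos by (intro divide_left_mono) auto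
    finally show "h \<le> W\<^sup>2" using \<epsilon>W by simp
  qed
  have strong: "h * real n * scalar_prod v v \<le> (\<Sum>j\<in>B i. (scalar_prod (x j) v)\<^sup>2)"
    if "i \<in> I" "v \<in> carrier_vec d" for i v
  proof -
    have "\<epsilon> / (real k * W\<^sup>2) * real n \<le> real (card (B i))"
      using that n by (simp add: I_def pos_le_divide_eq)
    from mult_left_mono[OF this, of lmin] have "h * real n \<le> lmin * real (card (B i))"
      using pos by (simp add: h_def ac_simps)
    then have "h * real n * scalar_prod v v \<le> lmin * real (card (B i)) * scalar_prod v v"
      by (intro mult_right_mono scalar_prod_self_nonneg)
    also have "\<dots> \<le> (\<Sum>j\<in>B i. (scalar_prod (x j) v)\<^sup>2)"
      using that by (intro lower) (auto simp: I_def)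
    finally show ?thesis .
  qed
  \<comment> \<open>Outside these events the empirical excess is positive on the whole level set, as
    the convexity argument demands.\<close>
  define bad where "bad = (\<lambda>i. {xs. \<exists>v\<in>carrier_vec d. (\<Sum>j\<in>B i. (scalar_prod (x j) v)\<^sup>2) = h * real n \<and>
        (\<Sum>j\<leftarrow>xs. excess x (residual x y (\<theta> i)) (B i) v j) \<le> 0})"
  have prob_bad: "measure_pmf.prob ?p (bad i)
      \<le> (400 * W\<^sup>2 * real d / h) ^ d * exp (- (real m * h / (256 * W\<^sup>2)))" if i: "i \<in> I" for i
  proof -
    have ik: "i < k" using i by (simp add: I_def)
    show ?thesis
      unfolding bad_def
    proof (rule prob_excess_nonpos_le[OF n d B[OF ik] W h(1,2) xB[OF ik]])
      fix j assume "j \<in> B i"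
      then have j: "j < n" using B[OF ik] by auto
      show "vec_norm2 (x j) \<le> W" by (rule bounds(2)[OF j])
      have "\<theta> i - \<theta> i = 0\<^sub>v d" using \<theta>[OF ik] by simp
      then show "\<bar>residual x y (\<theta> i) j\<bar> \<le> W"
        by (intro near[OF ik j \<theta>[OF ik]]) (simp add: vec_norm2_def)
    next
      fix v :: "real vec" assume v: "v \<in> carrier_vec d"
      show "(\<Sum>j\<in>B i. residual x y (\<theta> i) j * scalar_prod (x j) v) = 0"
        by (rule ls_normal_equation[OF fin[OF ik] xB[OF ik] ls[OF ik] v])
    qed (use i strong in auto)
  qed
  have good: "mset xs \<in> ?G" if xs: "xs \<in> set_pmf ?p" "xs \<notin> (\<Union>i\<in>I. bad i)" for xs
  proof (intro CollectI allI impI)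
    fix \<theta>p assume out: "subsampling_output d n k x y (mset xs) \<theta>p"
    have "{..<n} \<noteq> {}" using n by (auto simp: lessThan_empty_iff)
    then have sub: "set_mset (mset xs) \<subseteq> {..<n}" using xs(1) by (auto simp: set_replicate_pmf)
    obtain \<Theta> where \<Theta>': "\<And>i. i < k \<Longrightarrow> is_ls_solution d x y
        (if i < k then filter_mset (\<lambda>j. j \<in> B i) (mset xs) else {#}) (\<Theta> i)"
      and le: "min_loss n k x y \<theta>p \<le> min_loss n k x y \<Theta>"
      using subsampling_output_improves[OF out is_mset_partition_filter[OF part sub]] by blast
    have \<Theta>: "is_ls_solution d x y (filter_mset (\<lambda>j. j \<in> B i) (mset xs)) (\<Theta> i)"
      "\<Theta> i \<in> carrier_vec d" if "i < k" for i
      using \<Theta>'[OF that] that by (simp_all add: is_ls_solution_def is_arg_min_linorder)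
    have level: "(\<Sum>j\<in>B i. (scalar_prod (x j) (\<Theta> i - \<theta> i))\<^sup>2) \<le> h * real n" if i: "i \<in> I" for i
    proof -
      have ik: "i < k" using i by (simp add: I_def)
      show ?thesis
      proof (rule ls_solution_in_level_set[OF _ xB[OF ik] \<theta>[OF ik] \<Theta>(1)[OF ik]])
        show "0 < h * real n" using h n by simp
      next
        fix v assume "v \<in> carrier_vec d" "(\<Sum>j\<in>B i. (scalar_prod (x j) v)\<^sup>2) = h * real n"
        then show "0 < (\<Sum>j\<leftarrow>xs. excess x (residual x y (\<theta> i)) (B i) v j)"
          using xs(2) i unfolding bad_def by (force simp: not_le)
      qed
    qed
    have "min_loss n k x y \<Theta> \<le> min_loss n k x y \<theta> + \<epsilon>"
    proof (rule min_loss_near_optimal[OF n k x opt \<Theta>(2) i0I])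
      show "I \<subseteq> {..<k}" by (auto simp: I_def)
    next
      fix i assume "i \<in> I"
      then have "(\<Sum>j\<in>B i. (scalar_prod (x j) (\<Theta> i - \<theta> i))\<^sup>2) \<le> h * real n" by (rule level)
      also have "\<dots> \<le> \<epsilon> / real k * real n" using h by (intro mult_right_mono) auto
      finally show "(\<Sum>j\<in>B i. (scalar_prod (x j) (\<Theta> i - \<theta> i))\<^sup>2) \<le> real n * (\<epsilon> / real k)"
        by (simp add: mult.commute)
    next
      fix i assume "i < k" "i \<notin> I"
      then have "real (card (B i)) / real n \<le> \<epsilon> / (real k * W\<^sup>2)" by (auto simp: I_def)
      then show "real (card (B i)) * W\<^sup>2 \<le> real n * (\<epsilon> / real k)"
        using n k W2 by (simp add: field_simps)
    next
      fix j assume j: "j < n"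
      let ?v = "\<Theta> i0 - \<theta> i0"
      have v: "?v \<in> carrier_vec d" using \<Theta>(2)[OF i0(1)] \<theta>[OF i0(1)] by auto
      \<comment> \<open>On the level set and inside it the parameter moves by at most 1, so
        \<open>near\<close> controls the residuals of \<open>\<Theta> i0\<close> on all samples,
        including those of the small clusters.\<close>
      have "h * real n * scalar_prod ?v ?v \<le> h * real n * 1"
        using strong[OF i0I v] level[OF i0I] by simp
      then have "scalar_prod ?v ?v \<le> 1" using h n by simp
      then show "\<bar>residual x y (\<Theta> i0) j\<bar> \<le> W"
        by (intro near[OF i0(1) j \<Theta>(2)[OF i0(1)]]) (simp add: vec_norm2_def)
    qed
    with le show "min_loss n k x y \<theta>p \<le> min_loss n k x y \<theta> + \<epsilon>" by simp
  qed
  have "measure_pmf.prob ?p (\<Union>i\<in>I. bad i) \<le> (\<Sum>i\<in>I. measure_pmf.prob ?p (bad i))"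
    by (intro measure_pmf.finite_measure_subadditive_finite) (auto simp: I_def)
  also have "\<dots> \<le> (\<Sum>i\<in>I. (400 * W\<^sup>2 * real d / h) ^ d * exp (- (real m * h / (256 * W\<^sup>2))))"
    by (intro sum_mono prob_bad)
  also have "\<dots> \<le> (\<Sum>i<k. (400 * W\<^sup>2 * real d / h) ^ d * exp (- (real m * h / (256 * W\<^sup>2))))"
    using h by (intro sum_mono2) (auto simp: I_def)
  also have "\<dots> \<le> \<delta>"
    using sample_size_union_bound[OF d k pos \<delta> W h_def m] by simp
  finally have "1 - \<delta> \<le> measure_pmf.prob ?p (- (\<Union>i\<in>I. bad i))"
    using measure_pmf.prob_compl[of "\<Union>i\<in>I. bad i" ?p] by (simp add: Compl_eq_Diff_UNIV)
  also have "\<dots> = measure_pmf.prob ?p (- (\<Union>i\<in>I. bad i) \<inter> set_pmf ?p)"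
    by (simp add: measure_Int_set_pmf)
  also have "\<dots> \<le> measure_pmf.prob ?p (mset -` ?G)"
    using good by (intro measure_pmf.finite_measure_mono) auto
  finally show ?thesis by (simp add: subsample_def)
qed

theorem theorem4p7:
  shows "\<exists>p::nat. \<forall>b R w Bd \<gamma> :: real. \<exists>C>0.
    \<forall>(d::nat) (n::nat) (k::nat) (x :: nat \<Rightarrow> real vec) (y :: nat \<Rightarrow> real)
     (B :: nat \<Rightarrow> nat set) (\<theta> :: nat \<Rightarrow> real vec)
     (\<alpha>::real) (lmin::real) (\<epsilon>::real) (\<delta>::real) (m::nat).
      1 \<le> d \<longrightarrow> 1 \<le> n \<longrightarrow> 1 \<le> k \<longrightarrow>
      (\<forall>i<n. x i \<in> carrier_vec d) \<longrightarrow>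
      is_optimal d n k x y B \<theta> \<longrightarrow>
      dataset_assumptions d n k x y B \<theta> \<alpha> lmin \<gamma> Bd b R w \<longrightarrow>
      0 < \<epsilon> \<longrightarrow> 0 < \<delta> \<longrightarrow> \<delta> < 1 \<longrightarrow>
      enough_samples C p k d \<alpha> lmin \<epsilon> \<delta> m \<longrightarrow>
      measure_pmf.prob (subsample n m)
        {A. \<forall>\<theta>p. subsampling_output d n k x y A \<theta>p \<longrightarrow>
                 min_loss n k x y \<theta>p \<le> min_loss n k x y \<theta> + \<epsilon>} \<ge> 1 - 2 * \<delta>"
\<comment> \<open>One power of the logarithm suffices.\<close>
proof (rule exI[of _ "1::nat"], intro allI)
  fix b R w Bd \<gamma> :: real
  \<comment> \<open>A parameter within distance 1 of some \<open>\<theta> i\<close> has norm at most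
    \<open>w + 1\<close>, so \<open>W\<close> bounds its residuals as well as the data. Absolute
    values are taken because the constant is fixed before any sign of \<open>b\<close>,
    \<open>R\<close>, \<open>w\<close> is known.\<close>
  define W where "W = 1 + \<bar>b\<bar> + \<bar>R\<bar> * (\<bar>w\<bar> + 1)"
  have W: "1 \<le> W" "\<bar>b\<bar> \<le> W" "\<bar>b\<bar> + \<bar>R\<bar> * (\<bar>w\<bar> + 1) \<le> W" "\<bar>R\<bar> \<le> W"
  proof -
    have "0 \<le> \<bar>R\<bar> * \<bar>w\<bar>" by simp
    then show "1 \<le> W" "\<bar>b\<bar> \<le> W" "\<bar>b\<bar> + \<bar>R\<bar> * (\<bar>w\<bar> + 1) \<le> W" "\<bar>R\<bar> \<le> W"
      unfolding W_def distrib_left by linarith+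
  qed
  let ?C = "256 * W ^ 4 * (ln (400 * W ^ 4) + 4)"
  have "1 \<le> W ^ 4" using W(1) by simp
  then have C: "0 < ?C"
    by (intro mult_pos_pos add_nonneg_pos ln_ge_zero) linarith+
  show "\<exists>C>0. \<forall>(d::nat) (n::nat) (k::nat) (x :: nat \<Rightarrow> real vec) (y :: nat \<Rightarrow> real)
     (B :: nat \<Rightarrow> nat set) (\<theta> :: nat \<Rightarrow> real vec)
     (\<alpha>::real) (lmin::real) (\<epsilon>::real) (\<delta>::real) (m::nat).
      1 \<le> d \<longrightarrow> 1 \<le> n \<longrightarrow> 1 \<le> k \<longrightarrow>
      (\<forall>i<n. x i \<in> carrier_vec d) \<longrightarrow>
      is_optimal d n k x y B \<theta> \<longrightarrow>
      dataset_assumptions d n k x y B \<theta> \<alpha> lmin \<gamma> Bd b R w \<longrightarrow>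
      0 < \<epsilon> \<longrightarrow> 0 < \<delta> \<longrightarrow> \<delta> < 1 \<longrightarrow>
      enough_samples C 1 k d \<alpha> lmin \<epsilon> \<delta> m \<longrightarrow>
      measure_pmf.prob (subsample n m)
        {A. \<forall>\<theta>p. subsampling_output d n k x y A \<theta>p \<longrightarrow>
                 min_loss n k x y \<theta>p \<le> min_loss n k x y \<theta> + \<epsilon>} \<ge> 1 - 2 * \<delta>"
  proof (rule exI[of _ ?C], intro conjI C allI impI)
    fix d n k :: nat and x :: "nat \<Rightarrow> real vec" and y :: "nat \<Rightarrow> real"
      and B :: "nat \<Rightarrow> nat set" and \<theta> :: "nat \<Rightarrow> real vec" and \<alpha> lmin \<epsilon> \<delta> :: real and m :: nat
    assume dnk: "1 \<le> d" "1 \<le> n" "1 \<le> k" and x: "\<forall>i<n. x i \<in> carrier_vec d"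
      and opt: "is_optimal d n k x y B \<theta>"
      and data: "dataset_assumptions d n k x y B \<theta> \<alpha> lmin \<gamma> Bd b R w"
      and \<epsilon>: "0 < \<epsilon>" and \<delta>: "0 < \<delta>" "\<delta> < 1"
      and m: "enough_samples ?C 1 k d \<alpha> lmin \<epsilon> \<delta> m"
    have pos: "0 < \<alpha>" "0 < lmin"
      and lmin: "\<And>i. i < k \<Longrightarrow> lmin \<le> min_eigenvalue (second_moment d x (B i))"
      and y: "\<And>j. j < n \<Longrightarrow> \<bar>y j\<bar> \<le> b" and R: "\<And>j. j < n \<Longrightarrow> vec_norm2 (x j) \<le> R"
      and w: "\<And>i. i < k \<Longrightarrow> vec_norm2 (\<theta> i) \<le> w"
      using data unfolding dataset_assumptions_def by (auto simp: less_imp_le)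
    have \<theta>: "\<theta> i \<in> carrier_vec d" if "i < k" for i
      using opt that by (auto simp: is_optimal_def is_arg_min_linorder)
    have near: "\<bar>residual x y v j\<bar> \<le> W"
      if i: "i < k" and j: "j < n" and v: "v \<in> carrier_vec d" "vec_norm2 (v - \<theta> i) \<le> 1" for i j v
    proof -
      have xj: "x j \<in> carrier_vec d" using x j by simp
      have vv: "v - \<theta> i \<in> carrier_vec d" using v \<theta>[OF i] by auto
      have norm_nonneg: "0 \<le> vec_norm2 u" for u by (simp add: vec_norm2_def scalar_prod_self_nonneg)
      have "\<bar>scalar_prod (x j) (\<theta> i)\<bar> \<le> vec_norm2 (x j) * vec_norm2 (\<theta> i)"
        by (rule abs_scalar_prod_le[OF xj \<theta>[OF i]])
      also have "\<dots> \<le> \<bar>R\<bar> * \<bar>w\<bar>"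
        using R[OF j] w[OF i] norm_nonneg by (intro mult_mono) auto
      finally have a: "\<bar>scalar_prod (x j) (\<theta> i)\<bar> \<le> \<bar>R\<bar> * \<bar>w\<bar>" .
      have "\<bar>scalar_prod (x j) (v - \<theta> i)\<bar> \<le> vec_norm2 (x j) * vec_norm2 (v - \<theta> i)"
        by (rule abs_scalar_prod_le[OF xj vv])
      also have "\<dots> \<le> \<bar>R\<bar> * 1"
        using R[OF j] v(2) norm_nonneg by (intro mult_mono) auto
      finally have "\<bar>residual x y v j\<bar> \<le> \<bar>b\<bar> + (\<bar>R\<bar> * \<bar>w\<bar> + \<bar>R\<bar> * 1)"
        using a y[OF j] residual_diff[of x j d "\<theta> i" v y, OF xj \<theta>[OF i] v(1)]
        unfolding residual_def by linarith
      then show ?thesis using W(3) by (simp add: distrib_left)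
    qed
    have "\<bar>y j\<bar> \<le> W" "vec_norm2 (x j) \<le> W" if "j < n" for j
      using y[OF that] R[OF that] W by linarith+
    then have "1 - \<delta> \<le> measure_pmf.prob (subsample n m)
        {A. \<forall>\<theta>p. subsampling_output d n k x y A \<theta>p \<longrightarrow>
                 min_loss n k x y \<theta>p \<le> min_loss n k x y \<theta> + \<epsilon>}"
      using x by (intro prob_subsampling_near_optimal[OF dnk _ opt pos \<epsilon> \<delta> lmin W(1) _ _ near m]) auto
    then show "1 - 2 * \<delta> \<le> measure_pmf.prob (subsample n m)
        {A. \<forall>\<theta>p. subsampling_output d n k x y A \<theta>p \<longrightarrow>
                 min_loss n k x y \<theta>p \<le> min_loss n k x y \<theta> + \<epsilon>}"
      using \<delta> by linarith
  qed
qed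

end
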